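(* Let $H$ be either the Petersen graph or the complete graph $K_4$, and let $G$ be any connected graph. Then \[ a'(G\Box H)\le a'(G)+a'(H)-1. \]
   Context: An acyclic edge colouring of a graph is an assignment of colours to its edges such that adjacent edges get distinct colours and the edge set of any cycle uses at least three distinct colours. The acyclic chromatic index $a'(G)$ is the least number of colours used in any acyclic edge colouring of $G$. The cartesian product $G_1\Box G_2$ of $G_1=(V_1,E_1)$ and $G_2=(V_2,E_2)$ has vertex set $V_1\times V_2$, with $(u_1,u_2)$ and $(v_1,v_2)$ adjacent if and only if either $u_1=v_1$ and $(u_2,v_2)\in E_2$, or $u_2=v_2$ and $(u_1,v_1)\in E_1$.
   Formalization: The claim is false for G a single vertex (a'(G)=0 and G□H is H) and for G=K_2 with H the Petersen graph (K_2□H is 4-regular, so it needs at least 5 colours, but the bound is 4); exactly these two cases are excluded. *)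

theory Defs
  imports "Graph_Theory.Graph_Theory"
begin

text \<open>
  A finite simple graph is a \<^locale>\<open>pair_graph\<close>: a finite, loop-free, symmetric
  digraph without parallel arcs. The two arcs \<open>(u, v)\<close> and \<open>(v, u)\<close> represent the one
  undirected edge \<open>{u, v}\<close>.
\<close>

definition uedges :: "'a pair_pre_digraph \<Rightarrow> 'a set set" where
  "uedges G = {{u, v} | u v. (u, v) \<in> parcs G}"

text \<open>
  In a symmetric digraph the closed walk \<open>u, v, u\<close> counts as a cycle, hence the bound on
  the length below.
\<close>

definition undirected_cycle :: "'a pair_pre_digraph \<Rightarrow> ('a \<times> 'a) list \<Rightarrow> bool" where
  "undirected_cycle G p \<longleftrightarrow> pre_digraph.cycle (with_proj G) p \<and> 3 \<le> length p"

definition walk_edges :: "('a \<times> 'a) list \<Rightarrow> 'a set set" where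
  "walk_edges p = (\<lambda>(u, v). {u, v}) ` set p"

definition proper_edge_colouring :: "'a pair_pre_digraph \<Rightarrow> ('a set \<Rightarrow> nat) \<Rightarrow> bool" where
  "proper_edge_colouring G c \<longleftrightarrow>
    (\<forall>e\<in>uedges G. \<forall>f\<in>uedges G. e \<noteq> f \<and> e \<inter> f \<noteq> {} \<longrightarrow> c e \<noteq> c f)"

definition acyclic_edge_colouring :: "'a pair_pre_digraph \<Rightarrow> ('a set \<Rightarrow> nat) \<Rightarrow> bool" where
  "acyclic_edge_colouring G c \<longleftrightarrow> proper_edge_colouring G c \<and>
    (\<forall>p. undirected_cycle G p \<longrightarrow> 3 \<le> card (c ` walk_edges p))"

definition acyclic_chromatic_index :: "'a pair_pre_digraph \<Rightarrow> nat" where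
  "acyclic_chromatic_index G =
    (LEAST k. \<exists>c. acyclic_edge_colouring G c \<and> card (c ` uedges G) = k)"

definition box_product ::
  "'a pair_pre_digraph \<Rightarrow> 'b pair_pre_digraph \<Rightarrow> ('a \<times> 'b) pair_pre_digraph"  (infixr \<open>\<box>\<close> 80)
where
  "G \<box> H = \<lparr>
    pverts = pverts G \<times> pverts H,
    parcs = {((u1, u2), (v1, v2)) | u1 u2 v1 v2.
      u1 = v1 \<and> u1 \<in> pverts G \<and> (u2, v2) \<in> parcs H \<or>
      u2 = v2 \<and> u2 \<in> pverts H \<and> (u1, v1) \<in> parcs G} \<rparr>"

text \<open>
  Two degenerate values of \<open>G\<close> violate the bound
  \<open>a'(G \<box> H) \<le> a'(G) + a'(H) - 1\<close> and have to be excluded wherever it is stated.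
  If \<open>G\<close> is a single vertex, then \<open>a'(G) = 0\<close> and \<open>a'(G \<box> H) = a'(H)\<close>. If \<open>G\<close> is a single
  edge and \<open>H\<close> the Petersen graph, then the right-hand side is \<open>1 + 4 - 1 = 4\<close>, but
  \<open>G \<box> H\<close> is 4-regular: in a proper colouring with 4 colours each colour class is a perfect
  matching, and the union of two of them contains a bichromatic cycle.
\<close>

text \<open>The Petersen graph as the Kneser graph of the 2-subsets of a 5-set.\<close>

definition petersen_graph :: "nat set pair_pre_digraph" where
  "petersen_graph = \<lparr>
    pverts = {A. A \<subseteq> {0..<5} \<and> card A = 2},
    parcs = {(A, B). A \<subseteq> {0..<5} \<and> card A = 2 \<and> B \<subseteq> {0..<5} \<and> card B = 2 \<and> A \<inter> B = {}} \<rparr>"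

definition is_petersen_graph :: "'a pair_pre_digraph \<Rightarrow> bool" where
  "is_petersen_graph H \<longleftrightarrow> digraph_iso (with_proj petersen_graph) (with_proj H)"

lemma pair_graph_petersen_graph: "pair_graph petersen_graph"
proof unfold_locales
  have fin: "finite {A. A \<subseteq> {0..<5::nat} \<and> card A = 2}"
    by (rule finite_subset[of _ "Pow {0..<5}"]) auto
  then show "finite (pverts petersen_graph)"
    by (simp add: petersen_graph_def)
  have "parcs petersen_graph \<subseteq> pverts petersen_graph \<times> pverts petersen_graph"
    by (auto simp: petersen_graph_def)
  then show "finite (parcs petersen_graph)"
    using fin by (simp add: petersen_graph_def finite_subset)
  show "symmetric (with_proj petersen_graph)"
    by (auto simp: symmetric_def sym_def petersen_graph_def)
  show "fst e \<noteq> snd e" if "e \<in> parcs petersen_graph" for e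
    using that by (auto simp: petersen_graph_def)
qed (auto simp: petersen_graph_def)

lemma pair_graph_box_product:
  assumes "pair_graph G" "pair_graph H"
  shows "pair_graph (G \<box> H)"
proof -
  interpret G: pair_graph G by fact
  interpret H: pair_graph H by fact
  show ?thesis
  proof unfold_locales
    show wf1: "fst e \<in> pverts (G \<box> H)" if "e \<in> parcs (G \<box> H)" for e
      using that by (auto simp: box_product_def dest: G.wellformed' H.wellformed')
    show wf2: "snd e \<in> pverts (G \<box> H)" if "e \<in> parcs (G \<box> H)" for e
      using that by (auto simp: box_product_def dest: G.wellformed' H.wellformed')
    show fin: "finite (pverts (G \<box> H))"
      using G.pair_finite_verts H.pair_finite_verts by (simp add: box_product_def)
    have "parcs (G \<box> H) \<subseteq> pverts (G \<box> H) \<times> pverts (G \<box> H)"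
      using wf1 wf2 by (metis mem_Times_iff subsetI)
    then show "finite (parcs (G \<box> H))"
      using fin by (meson finite_SigmaI finite_subset)
    show "symmetric (with_proj (G \<box> H))"
      by (auto simp: symmetric_def sym_def box_product_def dest: G.arcs_symmetric H.arcs_symmetric)
    show "fst e \<noteq> snd e" if "e \<in> parcs (G \<box> H)" for e
      using that by (auto simp: box_product_def dest: G.no_loops' H.no_loops')
  qed
qed

end

theory Submission
  imports Defs
begin

text \<open>
  Let \<open>G\<close> be coloured acyclically with \<open>n = a'(G)\<close> colours. The idea is to give all copies of \<open>H\<close> in
  \<open>G \<box> H\<close> the same colouring, and to recolour the copy of \<open>G\<close> over each vertex \<open>h\<close> of \<open>H\<close> by an
  injection from the \<open>n\<close> colours of \<open>G\<close> into those colours that the edges of \<open>H\<close> at \<open>h\<close> leave free.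
  If \<open>H\<close> is cubic, this uses at least \<open>n + 3\<close> colours. For the Petersen graph this minimum has to be
  attained; for \<open>K\<^sub>4\<close> there may be \<open>n + 4\<close> colours.

  Such data on \<open>H\<close> alone form a \<open>slot_colouring\<close>: at each vertex \<open>h\<close>, each of the \<open>k\<close> colours is
  either the colour of an edge of \<open>H\<close> at \<open>h\<close> or a port, that is, reserved for the edges of \<open>G\<close> with
  one given label \<open>i < n\<close>. The product colouring is proper by construction. To see when it is
  acyclic, follow an alternating walk in two colours \<open>a\<close> and \<open>b\<close>. Inside one copy of \<open>H\<close> it runs
  through a Kempe chain of \<open>H\<close>, and it can leave this chain only at an end vertex where \<open>a\<close> or \<open>b\<close>
  is a port; it then crosses an edge of \<open>G\<close> and runs through the same chain in the opposite
  direction. If the two ends of each chain have ports with different labels \<open>i\<close> and \<open>j\<close>, then the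
  projection of the walk to \<open>G\<close> alternates between the colours \<open>i\<close> and \<open>j\<close>, and so it does not close
  up, since the colouring of \<open>G\<close> is acyclic. This condition concerns \<open>H\<close> only, and it is the last
  clause of \<open>slot_colouring\<close>. The formal argument replaces two-coloured cycles by two-coloured cores,
  that is, nonempty sets of vertices in which every vertex has a neighbour in either colour; a
  proper colouring is acyclic if and only if it has no core in two different colours. The outcome is
  \<open>acyclic_chromatic_index_box_product_le\<close>: if \<open>H\<close> has a slot colouring with \<open>k\<close> colours and at least
  \<open>a'(G)\<close> ports, then \<open>a'(G \<box> H) \<le> k\<close>.

  It remains to find slot colourings of the Petersen graph and of \<open>K\<^sub>4\<close> with \<open>n\<close> ports and \<open>n + 3\<close>
  colours. One with two ports extends to one with \<open>2 + m\<close> ports if \<open>H\<close> has a proper vertex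
  colouring with \<open>m\<close> colours: the \<open>m\<close> new colours are ports, rotated at \<open>h\<close> by the vertex colour
  of \<open>h\<close> (\<open>slot_colouring_add_shifted_ports\<close>). Only the few small values of \<open>n\<close> need an explicit
  table, whose validity is a finite computation. For the Petersen graph this covers all \<open>n \<ge> 2\<close>, and
  \<open>a'(G) \<ge> 2\<close> because \<open>G\<close> is neither a vertex nor an edge. For \<open>K\<^sub>4\<close> it covers enough values of \<open>n\<close>,
  because there one more colour is available. Finally, the right-hand side of the claim is large
  enough, since \<open>a'(H) \<ge> 4\<close> for the Petersen graph and \<open>a'(H) \<ge> 5\<close> for \<open>K\<^sub>4\<close>.
\<close>

section \<open>Two-coloured cores\<close>

text \<open>
  A substitute for cycles with the colours \<open>a\<close> and \<open>b\<close>. Unlike a cycle it carries no order, and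
  it may consist of many cycles at once, so it can be projected from \<open>G \<box> H\<close> to \<open>G\<close> without any
  bookkeeping of walks.
\<close>

definition two_coloured_core ::
  "'a pair_pre_digraph \<Rightarrow> ('a set \<Rightarrow> nat) \<Rightarrow> nat \<Rightarrow> nat \<Rightarrow> 'a set \<Rightarrow> bool" where
  "two_coloured_core G c a b S \<longleftrightarrow> S \<noteq> {} \<and>
    (\<forall>v\<in>S. (\<exists>w\<in>S. (v, w) \<in> parcs G \<and> c {v, w} = a) \<and>
           (\<exists>w\<in>S. (v, w) \<in> parcs G \<and> c {v, w} = b))"

lemma in_uedges: "(u, v) \<in> parcs G \<Longrightarrow> {u, v} \<in> uedges G"
  by (auto simp: uedges_def)

lemma finite_uedges:
  assumes "pair_graph G"
  shows "finite (uedges G)"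
proof -
  interpret pair_graph G by fact
  have "uedges G = (\<lambda>(u, v). {u, v}) ` parcs G"
    by (auto simp: uedges_def)
  then show ?thesis
    using pair_finite_arcs by simp
qed

lemma proper_edge_colouringD:
  assumes "proper_edge_colouring G c" "(u, v) \<in> parcs G" "(u, w) \<in> parcs G" "c {u, v} = c {u, w}"
  shows "v = w"
proof (rule ccontr)
  assume "v \<noteq> w"
  then have "{u, v} \<noteq> {u, w}"
    by (auto simp: doubleton_eq_iff)
  moreover have "{u, v} \<inter> {u, w} \<noteq> {}"
    by simp
  ultimately show False
    using assms(1,4) in_uedges[OF assms(2)] in_uedges[OF assms(3)]
    unfolding proper_edge_colouring_def by metis
qed

lemma pcas_of_sequence:
  assumes "i \<le> j"
  shows "pcas (w i) (map (\<lambda>k. (w k, w (Suc k))) [i..<j]) (w j)"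
  using assms by (induction rule: inc_induct) (simp_all add: upt_conv_Cons)

lemma tl_pawalk_verts:
  assumes "p \<noteq> []"
  shows "pcas u p v \<Longrightarrow> tl (pawalk_verts u p) = map snd p"
  using pre_digraph.awalk_verts_conv'[of "with_proj G" u p v for G] assms
  by (simp add: cas_with_proj_eq awalk_verts_with_proj_eq)

text \<open>
  Inside a core an alternating walk never gets stuck, so by finiteness it repeats a vertex. The
  segment up to the first repetition is a cycle; it is not of length two, because its first two
  edges have different colours.
\<close>

lemma acyclic_imp_no_core:
  assumes G: "pair_graph G" and c: "acyclic_edge_colouring G c" and "a \<noteq> b"
  shows "\<not> two_coloured_core G c a b S"
proof
  interpret pair_graph G by fact
  assume core: "two_coloured_core G c a b S"
  then obtain v0 where v0: "v0 \<in> S"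
    by (auto simp: two_coloured_core_def)
  obtain f where f: "\<And>v. v \<in> S \<Longrightarrow> f v \<in> S \<and> (v, f v) \<in> parcs G \<and> c {v, f v} = a"
    using core unfolding two_coloured_core_def by metis
  obtain g where g: "\<And>v. v \<in> S \<Longrightarrow> g v \<in> S \<and> (v, g v) \<in> parcs G \<and> c {v, g v} = b"
    using core unfolding two_coloured_core_def by metis
  define w where "w = rec_nat v0 (\<lambda>k x. if even k then f x else g x)"
  have w_Suc: "w (Suc k) = (if even k then f (w k) else g (w k))" for k
    by (simp add: w_def)
  have w_in: "w k \<in> S" for k
  proof (induction k)
    case 0
    show ?case using v0 by (simp add: w_def)
  next
    case (Suc k)
    then show ?case using f g by (simp add: w_Suc)
  qed
  have arc: "(w k, w (Suc k)) \<in> parcs G"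
    and col: "c {w k, w (Suc k)} = (if even k then a else b)" for k
    using f[OF w_in] g[OF w_in] by (simp_all add: w_Suc)
  have "w ` UNIV \<subseteq> pverts G"
    using arc in_arcsD1 by blast
  then have "finite (range w)"
    using pair_finite_verts finite_subset by blast
  then have "\<not> inj w"
    using finite_imageD infinite_UNIV_nat by blast
  then have "\<exists>j. \<exists>i<j. w i = w j"
    by (metis injI linorder_neqE_nat)
  \<comment> \<open>The first repetition closes a cycle.\<close>
  then obtain i j where ij: "i < j" "w i = w j"
    and least: "\<And>k l. k < l \<Longrightarrow> l < j \<Longrightarrow> w k \<noteq> w l"
    unfolding exists_least_iff[of "\<lambda>j. \<exists>i<j. w i = w j"] by blast
  have "j \<noteq> Suc i"
    using arc[of i] ij no_loops' by auto
  moreover have "j \<noteq> Suc (Suc i)"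
    using col[of i] col[of "Suc i"] ij \<open>a \<noteq> b\<close> by (auto simp: insert_commute split: if_splits)
  ultimately have len: "3 \<le> j - i"
    using ij by linarith
  define p where "p = map (\<lambda>k. (w k, w (Suc k))) [i..<j]"
  have p_ne: "p \<noteq> []"
    using ij by (simp add: p_def)
  have cas: "pcas (w i) p (w i)"
    using pcas_of_sequence[of i j w] ij by (simp add: p_def)
  have "inj_on w {Suc i..j}"
  proof (rule linorder_inj_onI)
    fix x y assume xy: "x < y" "x \<in> {Suc i..j}" "y \<in> {Suc i..j}"
    show "w x \<noteq> w y"
    proof (cases "y = j")
      case True
      then show ?thesis using least[of i x] xy ij by auto
    next
      case False
      then show ?thesis using least[of x y] xy by auto
    qed
  qed auto
  moreover have "map snd p = map w [Suc i..<Suc j]"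
    by (simp add: p_def map_Suc_upt[symmetric] del: map_Suc_upt upt_Suc)
  ultimately have "distinct (map snd p)"
    by (simp only: distinct_map) (simp add: atLeastLessThanSuc_atLeastAtMost del: upt_Suc)
  moreover have "w i \<in> pverts G" "set p \<subseteq> parcs G"
    using in_arcsD1[OF arc] arc by (auto simp: p_def)
  ultimately have "cycle p"
    unfolding cycle_def awalk_def using cas p_ne tl_pawalk_verts[OF p_ne cas] by metis
  then have "undirected_cycle G p"
    using len by (simp add: undirected_cycle_def p_def)
  then have "3 \<le> card (c ` walk_edges p)"
    using c by (simp add: acyclic_edge_colouring_def)
  moreover have "c ` walk_edges p \<subseteq> {a, b}"
    using col by (auto simp: walk_edges_def p_def)
  then have "card (c ` walk_edges p) \<le> card {a, b}"
    by (intro card_mono) auto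
  ultimately show False
    using \<open>a \<noteq> b\<close> by simp
qed

lemma pcas_nth:
  assumes "pcas u p v" "p \<noteq> []"
  shows "fst (p ! 0) = u" "snd (p ! (length p - 1)) = v"
    "\<And>i. Suc i < length p \<Longrightarrow> fst (p ! Suc i) = snd (p ! i)"
proof -
  have "fst (p ! 0) = u \<and> snd (p ! (length p - 1)) = v \<and>
      (\<forall>i. Suc i < length p \<longrightarrow> fst (p ! Suc i) = snd (p ! i))"
    using assms
  proof (induction p arbitrary: u)
    case (Cons e es)
    show ?case
    proof (cases es)
      case Nil
      then show ?thesis using Cons.prems by auto
    next
      case (Cons e' es')
      then show ?thesis
        using Cons.IH[of "snd e"] Cons.prems by (auto simp: nth_Cons split: nat.splits)
    qed
  qed simp
  then show "fst (p ! 0) = u" "snd (p ! (length p - 1)) = v"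
    "\<And>i. Suc i < length p \<Longrightarrow> fst (p ! Suc i) = snd (p ! i)"
    by auto
qed

text \<open>
  On a properly coloured cycle with at most two colours, the two edges at each vertex have
  different colours. Hence exactly two colours occur, and every vertex of the cycle sees both.
\<close>

lemma proper_no_core_imp_acyclic:
  assumes G: "pair_graph G" and c: "proper_edge_colouring G c"
    and no_core: "\<And>a b S. a \<noteq> b \<Longrightarrow> \<not> two_coloured_core G c a b S"
  shows "acyclic_edge_colouring G c"
  unfolding acyclic_edge_colouring_def
proof (intro conjI allI impI c)
  interpret pair_graph G by fact
  fix p assume p: "undirected_cycle G p"
  show "3 \<le> card (c ` walk_edges p)"
  proof (rule ccontr)
    assume few: "\<not> 3 \<le> card (c ` walk_edges p)"
    define n where "n = length p"
    have n: "3 \<le> n"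
      using p by (simp add: undirected_cycle_def n_def)
    then have p_ne: "p \<noteq> []"
      by (auto simp: n_def)
    obtain u where u: "set p \<subseteq> parcs G" "pcas u p u" "distinct (tl (pawalk_verts u p))"
      using p by (auto simp: undirected_cycle_def cycle_def awalk_def)
    have dist: "distinct (map snd p)"
      using u tl_pawalk_verts[OF p_ne u(2)] by simp
    \<comment> \<open>Cyclic successor: \<open>p ! nxt i\<close> is the arc that leaves the end vertex of \<open>p ! i\<close>.\<close>
    define nxt where "nxt i = (if Suc i = n then 0 else Suc i)" for i
    have nxt_less: "nxt i < n" if "i < n" for i
      using that by (auto simp: nxt_def)
    have step: "fst (p ! nxt i) = snd (p ! i)" if "i < n" for i
      using that pcas_nth[OF u(2) p_ne] by (cases "Suc i = n") (auto simp: nxt_def simp flip: n_def)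
    have arc: "p ! i \<in> parcs G" if "i < n" for i
      using that u(1) by (auto simp: n_def)
    define S where "S = (\<lambda>i. snd (p ! i)) ` {..<n}"
    define C where "C = c ` walk_edges p"
    have "finite C"
      by (simp add: C_def walk_edges_def)
    have C_in: "c {fst (p ! i), snd (p ! i)} \<in> C" if "i < n" for i
      using that by (force simp: C_def walk_edges_def n_def)
    have two: "\<exists>u\<in>S. \<exists>w\<in>S. (v, u) \<in> parcs G \<and> (v, w) \<in> parcs G \<and> c {v, u} \<noteq> c {v, w} \<and>
        {c {v, u}, c {v, w}} \<subseteq> C" if "v \<in> S" for v
    proof -
      from that obtain i0 where i0: "i0 < n" "v = snd (p ! i0)"
        by (auto simp: S_def)
      define j where "j = (if i0 = 0 then n - 1 else i0 - 1)"
      have j: "j < n" "nxt j = i0"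
        using i0 n by (auto simp: j_def nxt_def)
      define k where "k = nxt i0"
      have k: "k < n" "k \<noteq> j"
        using i0 n nxt_less by (auto simp: k_def j_def nxt_def)
      let ?u = "snd (p ! j)" and ?w = "snd (p ! k)"
      have "?u \<noteq> ?w"
        using dist k j by (simp add: distinct_conv_nth n_def)
      moreover have "fst (p ! i0) = ?u" "fst (p ! k) = v"
        using step[OF j(1)] step[OF i0(1)] i0 j by (simp_all add: k_def)
      moreover from this have "(?u, v) \<in> parcs G" "(v, ?w) \<in> parcs G"
        using arc[OF i0(1)] arc[OF k(1)] i0 by (metis prod.collapse)+
      moreover from this have "(v, ?u) \<in> parcs G"
        using arcs_symmetric by blast
      ultimately have "c {v, ?u} \<noteq> c {v, ?w}"
        using proper_edge_colouringD[OF c] by blast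
      moreover have "c {v, ?u} \<in> C" "c {v, ?w} \<in> C"
        using C_in[OF i0(1)] C_in[OF k(1)] \<open>fst (p ! i0) = ?u\<close> \<open>fst (p ! k) = v\<close> i0
        by (simp_all add: insert_commute)
      moreover have "?u \<in> S" "?w \<in> S"
        using j k by (auto simp: S_def)
      ultimately show ?thesis
        using \<open>(v, ?u) \<in> parcs G\<close> \<open>(v, ?w) \<in> parcs G\<close> by blast
    qed
    have "S \<noteq> {}"
      using n by (simp add: S_def lessThan_empty_iff)
    then obtain a b where ab: "a \<noteq> b" "{a, b} \<subseteq> C"
      using two by (metis ex_in_conv)
    have C_eq: "C = {x, y}" if "x \<noteq> y" "{x, y} \<subseteq> C" for x y
      using few card_seteq[OF \<open>finite C\<close> that(2)] that(1) by (simp add: C_def)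
    have "two_coloured_core G c a b S"
      unfolding two_coloured_core_def
    proof (intro conjI ballI \<open>S \<noteq> {}\<close>)
      fix v assume "v \<in> S"
      from two[OF this] obtain u w where uw: "u \<in> S" "w \<in> S" "(v, u) \<in> parcs G" "(v, w) \<in> parcs G"
        "c {v, u} \<noteq> c {v, w}" "{c {v, u}, c {v, w}} \<subseteq> C"
        by blast
      moreover from this have "{c {v, u}, c {v, w}} = {a, b}"
        using C_eq[OF uw(5,6)] C_eq[OF ab] by simp
      ultimately show "\<exists>w\<in>S. (v, w) \<in> parcs G \<and> c {v, w} = a"
        and "\<exists>w\<in>S. (v, w) \<in> parcs G \<and> c {v, w} = b"
        by (auto simp: doubleton_eq_iff)
    qed
    then show False
      using no_core ab by blast
  qed
qed

section \<open>The acyclic chromatic index\<close>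

text \<open>
  Giving every edge its own colour is acyclic, so the minimum that defines the acyclic chromatic
  index is taken over a nonempty set of numbers.
\<close>

lemma ex_acyclic_edge_colouring:
  assumes G: "pair_graph G"
  shows "\<exists>c. acyclic_edge_colouring G c"
proof -
  interpret pair_graph G by fact
  obtain c :: "'a set \<Rightarrow> nat" where c: "inj_on c (uedges G)"
    using finite_imp_inj_to_nat_seg[OF finite_uedges[OF G]] by blast
  have same: "{u, v} = {x, y}" if "(u, v) \<in> parcs G" "(x, y) \<in> parcs G" "c {u, v} = c {x, y}"
    for u v x y
    using that c by (meson in_uedges inj_onD)
  have "acyclic_edge_colouring G c"
  proof (rule proper_no_core_imp_acyclic[OF G])
    show "proper_edge_colouring G c"
      using c by (auto simp: proper_edge_colouring_def dest: inj_onD)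
    fix a b :: nat and S assume "a \<noteq> b"
    show "\<not> two_coloured_core G c a b S"
    proof
      assume core: "two_coloured_core G c a b S"
      then obtain v w where vw: "v \<in> S" "w \<in> S" "(v, w) \<in> parcs G" "c {v, w} = a"
        unfolding two_coloured_core_def by blast
      obtain x y where xy: "(v, x) \<in> parcs G" "c {v, x} = b" "(w, y) \<in> parcs G" "c {w, y} = b"
        using core vw unfolding two_coloured_core_def by blast
      then have "{v, x} = {w, y}"
        using same by metis
      moreover have "v \<noteq> w"
        using vw no_loops' by blast
      ultimately have "{v, x} = {v, w}"
        by (auto simp: doubleton_eq_iff)
      then show False
        using vw xy \<open>a \<noteq> b\<close> by simp
    qed
  qed
  then show ?thesis
    by blast
qed

lemma acyclic_chromatic_index_le:
  "acyclic_edge_colouring G c \<Longrightarrow> acyclic_chromatic_index G \<le> card (c ` uedges G)"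
  unfolding acyclic_chromatic_index_def by (rule Least_le) blast

lemma acyclic_chromatic_index_attained:
  assumes "pair_graph G"
  obtains c where "acyclic_edge_colouring G c" "card (c ` uedges G) = acyclic_chromatic_index G"
proof -
  have "\<exists>k c. acyclic_edge_colouring G c \<and> card (c ` uedges G) = k"
    using ex_acyclic_edge_colouring[OF assms] by simp
  then have "\<exists>c. acyclic_edge_colouring G c \<and> card (c ` uedges G) = acyclic_chromatic_index G"
    unfolding acyclic_chromatic_index_def by (rule LeastI_ex)
  then show ?thesis
    using that by (elim exE conjE)
qed

lemma le_acyclic_chromatic_indexI:
  assumes "pair_graph G" "\<And>c. acyclic_edge_colouring G c \<Longrightarrow> k \<le> card (c ` uedges G)"
  shows "k \<le> acyclic_chromatic_index G"
  by (rule acyclic_chromatic_index_attained[OF assms(1)]) (use assms(2) in fastforce)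

text \<open>
  Acyclicity only depends on which edges share a colour. This allows an optimal colouring to be
  renamed to an initial segment of the natural numbers, whose elements then serve as port labels.
\<close>

lemma acyclic_edge_colouring_comp:
  assumes c: "acyclic_edge_colouring G c" and f: "inj_on f (c ` uedges G)"
  shows "acyclic_edge_colouring G (f \<circ> c)"
  unfolding acyclic_edge_colouring_def
proof (intro conjI allI impI)
  have "c e = c e'" if "e \<in> uedges G" "e' \<in> uedges G" "(f \<circ> c) e = (f \<circ> c) e'" for e e'
    by (rule inj_onD[OF f]) (use that in auto)
  then show "proper_edge_colouring G (f \<circ> c)"
    using c unfolding acyclic_edge_colouring_def proper_edge_colouring_def by blast
  fix p assume p: "undirected_cycle G p"
  then have "set p \<subseteq> parcs G"
    by (auto simp: undirected_cycle_def pre_digraph.cycle_def pre_digraph.awalk_def)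
  then have "walk_edges p \<subseteq> uedges G"
    by (auto simp: walk_edges_def uedges_def)
  then have "inj_on f (c ` walk_edges p)"
    using f by (meson image_mono inj_on_subset)
  then have "card ((f \<circ> c) ` walk_edges p) = card (c ` walk_edges p)"
    unfolding image_comp[symmetric] by (rule card_image)
  then show "3 \<le> card ((f \<circ> c) ` walk_edges p)"
    using c p by (simp add: acyclic_edge_colouring_def)
qed

lemma optimal_colouring_below:
  assumes "pair_graph G"
  obtains c where "acyclic_edge_colouring G c" "c ` uedges G \<subseteq> {..<acyclic_chromatic_index G}"
proof -
  obtain c where c: "acyclic_edge_colouring G c" "card (c ` uedges G) = acyclic_chromatic_index G"
    using acyclic_chromatic_index_attained[OF assms] .
  have "finite (c ` uedges G)"
    using finite_uedges[OF assms] by simp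
  then obtain f where "bij_betw f (c ` uedges G) {..<acyclic_chromatic_index G}"
    using finite_same_card_bij[of "c ` uedges G" "{..<acyclic_chromatic_index G}"] c(2) by auto
  then show ?thesis
    using that[OF acyclic_edge_colouring_comp[OF c(1), of f]]
    unfolding bij_betw_def image_comp[symmetric] by auto
qed

section \<open>Slot colourings\<close>

text \<open>
  The role of a colour at a vertex \<open>h\<close> of \<open>H\<close>. It either colours the edge from \<open>h\<close> to the given
  neighbour, in every copy of \<open>H\<close>, or it colours, in the copy of \<open>G\<close> over \<open>h\<close>, those edges to
  which the colouring of \<open>G\<close> assigns the given label.
\<close>

datatype 'b slot = Nbr 'b | Port nat

definition kempe_step :: "'b set \<Rightarrow> ('b \<Rightarrow> nat \<Rightarrow> 'b slot) \<Rightarrow> nat \<Rightarrow> nat \<Rightarrow> ('b \<times> 'b) set" where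
  "kempe_step V \<sigma> a b = {(x, y). x \<in> V \<and> (\<sigma> x a = Nbr y \<or> \<sigma> x b = Nbr y)}"

text \<open>
  The ports through which a walk in the colours \<open>a\<close> and \<open>b\<close> can leave the Kempe chain of \<open>h\<close>.
\<close>

definition kempe_ports :: "'b set \<Rightarrow> ('b \<Rightarrow> nat \<Rightarrow> 'b slot) \<Rightarrow> nat \<Rightarrow> nat \<Rightarrow> 'b \<Rightarrow> nat set" where
  "kempe_ports V \<sigma> a b h =
    {i. \<exists>x. (h, x) \<in> (kempe_step V \<sigma> a b)\<^sup>* \<and> (\<sigma> x a = Port i \<or> \<sigma> x b = Port i)}"

text \<open>
  All \<open>k\<close> colours are used up at every vertex of \<open>H\<close>: each is the colour of one incident edge or
  one of the \<open>n\<close> ports. The last clause is what makes the product colouring acyclic: a Kempe chain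
  that is a cycle would have no port at all, and a Kempe chain with the same port at both ends
  would be closed up to a cycle by its copy across one edge of \<open>G\<close> with that label.
\<close>

definition slot_colouring ::
  "'b pair_pre_digraph \<Rightarrow> nat \<Rightarrow> nat \<Rightarrow> ('b \<Rightarrow> nat \<Rightarrow> 'b slot) \<Rightarrow> bool" where
  "slot_colouring H n k \<sigma> \<longleftrightarrow>
    (\<forall>h\<in>pverts H. inj_on (\<sigma> h) {..<k} \<and>
      (\<forall>w. (h, w) \<in> parcs H \<longrightarrow> Nbr w \<in> \<sigma> h ` {..<k}) \<and>
      (\<forall>i<n. Port i \<in> \<sigma> h ` {..<k}) \<and>
      (\<forall>b<k. \<forall>w. \<sigma> h b = Nbr w \<longrightarrow> (h, w) \<in> parcs H \<and> \<sigma> w b = Nbr h) \<and>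
      (\<forall>b<k. \<forall>i. \<sigma> h b = Port i \<longrightarrow> i < n) \<and>
      (\<forall>a<k. \<forall>b<k. a \<noteq> b \<longrightarrow>
        (\<exists>i\<in>kempe_ports (pverts H) \<sigma> a b h. \<exists>j\<in>kempe_ports (pverts H) \<sigma> a b h. i \<noteq> j)))"

lemma slot_colouringD:
  assumes "slot_colouring H n k \<sigma>" "h \<in> pverts H"
  shows slot_colouring_inj: "a < k \<Longrightarrow> b < k \<Longrightarrow> \<sigma> h a = \<sigma> h b \<Longrightarrow> a = b"
    and slot_colouring_ex_Nbr: "(h, w) \<in> parcs H \<Longrightarrow> \<exists>b<k. \<sigma> h b = Nbr w"
    and slot_colouring_ex_Port: "i < n \<Longrightarrow> \<exists>b<k. \<sigma> h b = Port i"
    and slot_colouring_Nbr: "b < k \<Longrightarrow> \<sigma> h b = Nbr w \<Longrightarrow> (h, w) \<in> parcs H \<and> \<sigma> w b = Nbr h"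
    and slot_colouring_Port_less: "b < k \<Longrightarrow> \<sigma> h b = Port i \<Longrightarrow> i < n"
    and slot_colouring_ends: "a < k \<Longrightarrow> b < k \<Longrightarrow> a \<noteq> b \<Longrightarrow>
      \<exists>i\<in>kempe_ports (pverts H) \<sigma> a b h. \<exists>j\<in>kempe_ports (pverts H) \<sigma> a b h. i \<noteq> j"
proof -
  note slots = assms(1)[unfolded slot_colouring_def, rule_format, OF assms(2)]
  show "a < k \<Longrightarrow> b < k \<Longrightarrow> \<sigma> h a = \<sigma> h b \<Longrightarrow> a = b"
    using slots by (meson inj_onD lessThan_iff)
  show "(h, w) \<in> parcs H \<Longrightarrow> \<exists>b<k. \<sigma> h b = Nbr w"
    using slots by (metis imageE lessThan_iff)
  show "i < n \<Longrightarrow> \<exists>b<k. \<sigma> h b = Port i"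
    using slots by (metis imageE lessThan_iff)
  show "b < k \<Longrightarrow> \<sigma> h b = Nbr w \<Longrightarrow> (h, w) \<in> parcs H \<and> \<sigma> w b = Nbr h"
    using slots by meson
  show "b < k \<Longrightarrow> \<sigma> h b = Port i \<Longrightarrow> i < n"
    using slots by meson
  show "a < k \<Longrightarrow> b < k \<Longrightarrow> a \<noteq> b \<Longrightarrow>
      \<exists>i\<in>kempe_ports (pverts H) \<sigma> a b h. \<exists>j\<in>kempe_ports (pverts H) \<sigma> a b h. i \<noteq> j"
    using slots by meson
qed

section \<open>The colouring of the product\<close>

lemma in_parcs_box_product:
  "((u, h), (v, w)) \<in> parcs (G \<box> H) \<longleftrightarrow>
    u = v \<and> u \<in> pverts G \<and> (h, w) \<in> parcs H \<or> h = w \<and> h \<in> pverts H \<and> (u, v) \<in> parcs G"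
  by (auto simp: box_product_def)

text \<open>
  The role that the arc from \<open>x\<close> to \<open>y\<close> of the product plays at its first end.
\<close>

definition slot_of :: "('a set \<Rightarrow> nat) \<Rightarrow> 'a \<times> 'b \<Rightarrow> 'a \<times> 'b \<Rightarrow> 'b slot" where
  "slot_of c x y = (if fst x = fst y then Nbr (snd y) else Port (c {fst x, fst y}))"

text \<open>
  An edge gets the colour whose slot it occupies. Edges are unordered, hence the quantification over
  the two ways of reading \<open>e\<close> as an arc; both give the same colour.
\<close>

definition product_colouring ::
  "('a set \<Rightarrow> nat) \<Rightarrow> ('b \<Rightarrow> nat \<Rightarrow> 'b slot) \<Rightarrow> nat \<Rightarrow> ('a \<times> 'b) set \<Rightarrow> nat" where
  "product_colouring c \<sigma> k e = (THE b. b < k \<and> (\<exists>x y. e = {x, y} \<and> x \<noteq> y \<and> \<sigma> (snd x) b = slot_of c x y))"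

context
  fixes G :: "'a pair_pre_digraph" and H :: "'b pair_pre_digraph"
    and c :: "'a set \<Rightarrow> nat" and \<sigma> :: "'b \<Rightarrow> nat \<Rightarrow> 'b slot" and n k :: nat
  assumes G: "pair_graph G" and H: "pair_graph H"
    and c: "acyclic_edge_colouring G c" and c_less: "c ` uedges G \<subseteq> {..<n}"
    and \<sigma>: "slot_colouring H n k \<sigma>"
begin

interpretation G: pair_graph G by (rule G)
interpretation H: pair_graph H by (rule H)

lemma slot_of_sym:
  assumes "(x, y) \<in> parcs (G \<box> H)" "b < k" "\<sigma> (snd x) b = slot_of c x y"
  shows "\<sigma> (snd y) b = slot_of c y x"
proof -
  obtain u h v w where xy: "x = (u, h)" "y = (v, w)"
    by (meson surj_pair)
  show ?thesis
  proof (cases "u = v")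
    case True
    then have "h \<in> pverts H"
      using assms xy by (auto simp: in_parcs_box_product dest: H.in_arcsD1 G.no_loops')
    then show ?thesis
      using True assms xy slot_colouring_Nbr[OF \<sigma>, of h b w] by (simp add: slot_of_def)
  next
    case False
    then show ?thesis
      using assms xy by (auto simp: in_parcs_box_product slot_of_def insert_commute)
  qed
qed

lemma product_colouring_arc:
  assumes "(x, y) \<in> parcs (G \<box> H)"
  shows "product_colouring c \<sigma> k {x, y} < k"
    and "\<sigma> (snd x) (product_colouring c \<sigma> k {x, y}) = slot_of c x y"
proof -
  interpret P: pair_graph "G \<box> H"
    using pair_graph_box_product[OF G H] .
  obtain u h v w where xy: "x = (u, h)" "y = (v, w)"
    by (meson surj_pair)
  have h: "h \<in> pverts H"
    using assms xy by (auto simp: in_parcs_box_product dest: H.in_arcsD1)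
  have "\<exists>b<k. \<sigma> h b = slot_of c x y"
  proof (cases "u = v")
    case True
    then show ?thesis
      using assms xy slot_colouring_ex_Nbr[OF \<sigma> h, of w]
      by (auto simp: in_parcs_box_product slot_of_def dest: G.no_loops')
  next
    case False
    then have "c {u, v} < n"
      using assms xy c_less by (auto simp: in_parcs_box_product dest!: in_uedges)
    then show ?thesis
      using False xy slot_colouring_ex_Port[OF \<sigma> h] by (simp add: slot_of_def)
  qed
  then obtain b where b: "b < k" "\<sigma> h b = slot_of c x y"
    by blast
  have "product_colouring c \<sigma> k {x, y} = b"
    unfolding product_colouring_def
  proof (rule the_equality)
    show "b < k \<and> (\<exists>x' y'. {x, y} = {x', y'} \<and> x' \<noteq> y' \<and> \<sigma> (snd x') b = slot_of c x' y')"
      using b xy P.no_loops'[OF assms] by force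
    fix b' assume b': "b' < k \<and>
      (\<exists>x' y'. {x, y} = {x', y'} \<and> x' \<noteq> y' \<and> \<sigma> (snd x') b' = slot_of c x' y')"
    then have "\<sigma> h b' = slot_of c x y"
      using slot_of_sym[of y x b'] P.arcs_symmetric[OF assms] xy by (auto simp: doubleton_eq_iff)
    then show "b' = b"
      using b b' slot_colouring_inj[OF \<sigma> h, of b' b] by simp
  qed
  then show "product_colouring c \<sigma> k {x, y} < k"
    and "\<sigma> (snd x) (product_colouring c \<sigma> k {x, y}) = slot_of c x y"
    using b xy by simp_all
qed

lemma proper_product_colouring: "proper_edge_colouring (G \<box> H) (product_colouring c \<sigma> k)"
proof -
  interpret P: pair_graph "G \<box> H"
    using pair_graph_box_product[OF G H] .
  have "y = z" if arcs: "(x, y) \<in> parcs (G \<box> H)" "(x, z) \<in> parcs (G \<box> H)"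
    and eq: "product_colouring c \<sigma> k {x, y} = product_colouring c \<sigma> k {x, z}" for x y z
  proof -
    have same: "slot_of c x y = slot_of c x z"
      using product_colouring_arc(2)[OF arcs(1)] product_colouring_arc(2)[OF arcs(2)] eq by simp
    obtain u h v w v' w' where xyz: "x = (u, h)" "y = (v, w)" "z = (v', w')"
      by (meson surj_pair)
    show ?thesis
    proof (cases "u = v")
      case True
      then show ?thesis
        using same xyz by (auto simp: slot_of_def split: if_splits)
    next
      case False
      then have "u \<noteq> v'" "c {u, v} = c {u, v'}"
        using same xyz by (auto simp: slot_of_def split: if_splits)
      then have "v = v'" "w = w'"
        using False arcs xyz proper_edge_colouringD[of G c u v v'] c
        by (auto simp: in_parcs_box_product acyclic_edge_colouring_def)
      then show ?thesis using xyz by simp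
    qed
  qed
  note inj = this
  show ?thesis
    unfolding proper_edge_colouring_def
  proof (intro ballI impI)
    fix e f assume e: "e \<in> uedges (G \<box> H)" and f: "f \<in> uedges (G \<box> H)" and ef: "e \<noteq> f \<and> e \<inter> f \<noteq> {}"
    then obtain x where x: "x \<in> e" "x \<in> f"
      by blast
    have "\<exists>y. (x, y) \<in> parcs (G \<box> H) \<and> e = {x, y}" if "e \<in> uedges (G \<box> H)" "x \<in> e" for e
      using that P.arcs_symmetric unfolding uedges_def by blast
    from this[OF e x(1)] this[OF f x(2)] obtain y z where
      "(x, y) \<in> parcs (G \<box> H)" "e = {x, y}" "(x, z) \<in> parcs (G \<box> H)" "f = {x, z}"
      by blast
    then show "product_colouring c \<sigma> k e \<noteq> product_colouring c \<sigma> k f"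
      using inj[of x y z] ef by auto
  qed
qed

text \<open>
  A core \<open>S\<close> of the product in the colours \<open>a\<close> and \<open>b\<close> is mapped to a core of \<open>G\<close>. Within a fixed
  copy of \<open>H\<close>, membership in \<open>S\<close> spreads along the whole Kempe chain of \<open>h\<close>. At a vertex of the
  chain where \<open>a\<close> or \<open>b\<close> is the port \<open>i\<close>, the partner in \<open>S\<close> is reached along an edge of \<open>G\<close> with
  label \<open>i\<close>, and in its copy of \<open>H\<close> one can return along the chain to \<open>h\<close>. As the chain has two
  different ports \<open>i\<close> and \<open>j\<close>, the vertices \<open>v\<close> with \<open>(v, h) \<in> S\<close> form a core of \<open>G\<close> in the
  colours \<open>i\<close> and \<open>j\<close>.
\<close>

lemma product_colouring_no_core:
  assumes "a \<noteq> b"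
  shows "\<not> two_coloured_core (G \<box> H) (product_colouring c \<sigma> k) a b S"
proof
  interpret P: pair_graph "G \<box> H"
    using pair_graph_box_product[OF G H] .
  assume core: "two_coloured_core (G \<box> H) (product_colouring c \<sigma> k) a b S"
  have partner: "\<exists>y\<in>S. (x, y) \<in> parcs (G \<box> H) \<and> d < k \<and> \<sigma> (snd x) d = slot_of c x y"
    if "x \<in> S" "d \<in> {a, b}" for x d
  proof -
    have "\<exists>y\<in>S. (x, y) \<in> parcs (G \<box> H) \<and> product_colouring c \<sigma> k {x, y} = d"
      using core that unfolding two_coloured_core_def by blast
    then show ?thesis
      using product_colouring_arc by blast
  qed
  have vertex: "v \<in> pverts G \<and> h \<in> pverts H" if "(v, h) \<in> S" for v h
  proof -
    from partner[OF that, of a] obtain y where "((v, h), y) \<in> parcs (G \<box> H)"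
      by blast
    then have "(v, h) \<in> pverts (G \<box> H)"
      by (rule P.in_arcsD1)
    then show ?thesis
      by (simp add: box_product_def)
  qed
  obtain u h where uh: "(u, h) \<in> S"
    using core by (auto simp: two_coloured_core_def)
  have ab: "a < k" "b < k"
    using partner[OF uh] by blast+
  let ?R = "kempe_step (pverts H) \<sigma> a b"
  have step: "(v, y) \<in> S" if "(v, x) \<in> S" "(x, y) \<in> ?R" for v x y
  proof -
    from that obtain d where "d \<in> {a, b}" "\<sigma> x d = Nbr y"
      by (auto simp: kempe_step_def)
    from partner[OF that(1) this(1)] this(2) show ?thesis
      by (auto simp: slot_of_def split: if_splits)
  qed
  have walk: "(v, y) \<in> S" if "(x, y) \<in> ?R\<^sup>*" "(v, x) \<in> S" for v x y
    using that by (induction rule: rtrancl_induct) (auto intro: step)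
  have "sym ?R"
  proof (rule symI)
    fix x y assume xy: "(x, y) \<in> ?R"
    then obtain d where "d \<in> {a, b}" "\<sigma> x d = Nbr y" "x \<in> pverts H"
      by (auto simp: kempe_step_def)
    moreover from this have "(x, y) \<in> parcs H" "\<sigma> y d = Nbr x"
      using slot_colouring_Nbr[OF \<sigma>, of x d y] ab by auto
    ultimately show "(y, x) \<in> ?R"
      using H.in_arcsD2 by (auto simp: kempe_step_def)
  qed
  then have retrace: "(y, x) \<in> ?R\<^sup>*" if "(x, y) \<in> ?R\<^sup>*" for x y
    using that sym_rtrancl symD by metis
  obtain i j where ports: "i \<in> kempe_ports (pverts H) \<sigma> a b h" "j \<in> kempe_ports (pverts H) \<sigma> a b h"
    and "i \<noteq> j"
    using slot_colouring_ends[OF \<sigma> _ ab \<open>a \<noteq> b\<close>, of h] vertex[OF uh] by blast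
  have cross: "\<exists>w. (w, h) \<in> S \<and> (v, w) \<in> parcs G \<and> c {v, w} = i"
    if v: "(v, h) \<in> S" and "i \<in> kempe_ports (pverts H) \<sigma> a b h" for v i
  proof -
    from that(2) obtain x d where x: "(h, x) \<in> ?R\<^sup>*" and d: "d \<in> {a, b}" "\<sigma> x d = Port i"
      by (auto simp: kempe_ports_def)
    have "(v, x) \<in> S"
      using walk[OF x v] .
    from partner[OF this d(1)] obtain w x' where w: "(w, x') \<in> S"
      "((v, x), (w, x')) \<in> parcs (G \<box> H)" "\<sigma> x d = slot_of c (v, x) (w, x')"
      by auto
    then have "v \<noteq> w" "c {v, w} = i"
      using d(2) by (auto simp: slot_of_def split: if_splits)
    then have "x' = x" "(v, w) \<in> parcs G"
      using w by (auto simp: in_parcs_box_product)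
    then show ?thesis
      using w walk[OF retrace[OF x]] \<open>c {v, w} = i\<close> by blast
  qed
  have "two_coloured_core G c i j {v. (v, h) \<in> S}"
    unfolding two_coloured_core_def
    using uh cross[OF _ ports(1)] cross[OF _ ports(2)] by blast
  then show False
    using acyclic_imp_no_core[OF G c \<open>i \<noteq> j\<close>] by blast
qed

lemma acyclic_product_colouring: "acyclic_edge_colouring (G \<box> H) (product_colouring c \<sigma> k)"
  using proper_no_core_imp_acyclic[OF pair_graph_box_product[OF G H] proper_product_colouring]
    product_colouring_no_core by blast

lemma product_colouring_less: "product_colouring c \<sigma> k ` uedges (G \<box> H) \<subseteq> {..<k}"
  using product_colouring_arc(1) by (auto simp: uedges_def)

end

text \<open>
  The labels of the ports are the colours of an optimal colouring of \<open>G\<close>, so there must be at least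
  as many ports as these; the colours of the product are the \<open>k\<close> slots.
\<close>

theorem acyclic_chromatic_index_box_product_le:
  assumes "pair_graph G" "pair_graph H" "slot_colouring H n k \<sigma>" "acyclic_chromatic_index G \<le> n"
  shows "acyclic_chromatic_index (G \<box> H) \<le> k"
proof -
  obtain c where c: "acyclic_edge_colouring G c" "c ` uedges G \<subseteq> {..<acyclic_chromatic_index G}"
    using optimal_colouring_below[OF assms(1)] .
  then have c_less: "c ` uedges G \<subseteq> {..<n}"
    using assms(4) by fastforce
  have "acyclic_chromatic_index (G \<box> H) \<le> card (product_colouring c \<sigma> k ` uedges (G \<box> H))"
    by (rule acyclic_chromatic_index_le[OF acyclic_product_colouring[OF assms(1,2) c(1) c_less assms(3)]])
  also have "\<dots> \<le> card {..<k}"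
    by (rule card_mono[OF _ product_colouring_less[OF assms(1,2) c(1) c_less assms(3)]]) simp
  finally show ?thesis
    by simp
qed

section \<open>Adding ports by cyclic shifts\<close>

lemma slot_colouringI:
  assumes "\<And>h. h \<in> pverts H \<Longrightarrow> inj_on (\<sigma> h) {..<k}"
    and "\<And>h w. h \<in> pverts H \<Longrightarrow> (h, w) \<in> parcs H \<Longrightarrow> Nbr w \<in> \<sigma> h ` {..<k}"
    and "\<And>h i. h \<in> pverts H \<Longrightarrow> i < n \<Longrightarrow> Port i \<in> \<sigma> h ` {..<k}"
    and "\<And>h b w. h \<in> pverts H \<Longrightarrow> b < k \<Longrightarrow> \<sigma> h b = Nbr w \<Longrightarrow> (h, w) \<in> parcs H \<and> \<sigma> w b = Nbr h"
    and "\<And>h b i. h \<in> pverts H \<Longrightarrow> b < k \<Longrightarrow> \<sigma> h b = Port i \<Longrightarrow> i < n"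
    and "\<And>h a b. h \<in> pverts H \<Longrightarrow> a < k \<Longrightarrow> b < k \<Longrightarrow> a \<noteq> b \<Longrightarrow>
      \<exists>i\<in>kempe_ports (pverts H) \<sigma> a b h. \<exists>j\<in>kempe_ports (pverts H) \<sigma> a b h. i \<noteq> j"
  shows "slot_colouring H n k \<sigma>"
  unfolding slot_colouring_def by (intro ballI conjI allI impI) (fact assms(1-3,5,6) conjunct1[OF assms(4)] conjunct2[OF assms(4)])+

lemma kempe_ports_commute: "kempe_ports V \<sigma> a b h = kempe_ports V \<sigma> b a h"
proof -
  have "kempe_step V \<sigma> a b = kempe_step V \<sigma> b a"
    by (auto simp: kempe_step_def)
  then show ?thesis
    by (auto simp: kempe_ports_def)
qed

lemma kempe_ports_here: "\<sigma> h a = Port i \<Longrightarrow> i \<in> kempe_ports V \<sigma> a b h"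
  by (auto simp: kempe_ports_def)

lemma kempe_ports_step:
  assumes "h \<in> V" "\<sigma> h a = Nbr w" "i \<in> kempe_ports V \<sigma> a b w"
  shows "i \<in> kempe_ports V \<sigma> a b h"
proof -
  have "(h, w) \<in> kempe_step V \<sigma> a b"
    using assms by (simp add: kempe_step_def)
  then show ?thesis
    using assms(3) unfolding kempe_ports_def by (auto intro: converse_rtrancl_into_rtrancl)
qed

text \<open>
  The colours \<open>k, \<dots>, k + m - 1\<close> become ports with labels \<open>n, \<dots>, n + m - 1\<close>, rotated at \<open>h\<close> by
  \<open>s h\<close>.
\<close>

definition add_shifted_ports ::
  "nat \<Rightarrow> nat \<Rightarrow> nat \<Rightarrow> ('b \<Rightarrow> nat) \<Rightarrow> ('b \<Rightarrow> nat \<Rightarrow> 'b slot) \<Rightarrow> 'b \<Rightarrow> nat \<Rightarrow> 'b slot" where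
  "add_shifted_ports n k m s \<sigma> h b =
    (if b < k then \<sigma> h b else Port (n + (b - k + s h) mod m))"

lemma add_mod_cancel_left:
  fixes x y d m :: nat
  shows "x < m \<Longrightarrow> y < m \<Longrightarrow> (d + x) mod m = (d + y) mod m \<Longrightarrow> x = y"
proof (induction x y rule: linorder_wlog)
  case (le x y)
  then have "m dvd (d + y) - (d + x)"
    by (metis add_left_mono mod_eq_dvd_iff_nat)
  then have "m dvd y - x"
    by simp
  then show ?case
    using le by (metis diff_is_0_eq dvd_imp_le le_antisym less_imp_diff_less not_le not_gr_zero)
qed simp

text \<open>
  A new colour \<open>b\<close> never lies on an edge of \<open>H\<close>, so Kempe chains involving \<open>b\<close> have at most one
  edge. If such a chain is an edge \<open>{h, w}\<close>, then \<open>b\<close> is a port at both ends, with labels that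
  differ because \<open>s\<close> is a proper vertex colouring with values below \<open>m\<close>. If it is the single vertex
  \<open>h\<close>, then both colours are ports there, and the ports at one vertex have distinct labels.
\<close>

lemma slot_colouring_add_shifted_ports:
  assumes \<sigma>: "slot_colouring H n k \<sigma>"
    and s: "\<And>h. h \<in> pverts H \<Longrightarrow> s h < m" "\<And>h w. (h, w) \<in> parcs H \<Longrightarrow> s h \<noteq> s w"
    and wf: "\<And>h w. (h, w) \<in> parcs H \<Longrightarrow> w \<in> pverts H"
  shows "slot_colouring H (n + m) (k + m) (add_shifted_ports n k m s \<sigma>)"
proof -
  let ?\<tau> = "add_shifted_ports n k m s \<sigma>"
  have old: "?\<tau> h b = \<sigma> h b" if "b < k" for h b
    using that by (simp add: add_shifted_ports_def)
  have new: "?\<tau> h b = Port (n + (b - k + s h) mod m)" if "\<not> b < k" for h b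
    using that by (simp add: add_shifted_ports_def)
  have new_inj: "a = b"
    if "\<not> a < k" "\<not> b < k" "a < k + m" "b < k + m" "(a - k + x) mod m = (b - k + x) mod m" for a b x
  proof -
    have "(x + (a - k)) mod m = (x + (b - k)) mod m"
      using that(5) by (simp only: add.commute)
    then have "a - k = b - k"
      using add_mod_cancel_left[of "a - k" m "b - k" x] that by linarith
    then show ?thesis
      using that by linarith
  qed
  have old_new: "\<exists>i\<in>kempe_ports (pverts H) ?\<tau> a b h. \<exists>j\<in>kempe_ports (pverts H) ?\<tau> a b h. i \<noteq> j"
    if h: "h \<in> pverts H" and a: "a < k" and b: "\<not> b < k" "b < k + m" for a b h
  proof -
    let ?p = "\<lambda>h. n + (b - k + s h) mod m"
    have here: "?p h \<in> kempe_ports (pverts H) ?\<tau> a b h" for h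
      using kempe_ports_here[of ?\<tau> h b "?p h" "pverts H" a] new[OF b(1)] kempe_ports_commute
      by metis
    show ?thesis
    proof (cases "\<sigma> h a")
      case (Nbr w)
      then have arc: "(h, w) \<in> parcs H"
        using slot_colouring_Nbr[OF \<sigma> h a] by blast
      have "?p w \<in> kempe_ports (pverts H) ?\<tau> a b h"
        using kempe_ports_step[OF h _ here] Nbr old[OF a] by metis
      moreover have "?p h \<noteq> ?p w"
        using add_mod_cancel_left[of "s h" m "s w" "b - k"] s(1)[OF h] s(1)[OF wf[OF arc]] s(2)[OF arc]
        by auto
      ultimately show ?thesis
        using here by blast
    next
      case (Port i)
      then have "i \<in> kempe_ports (pverts H) ?\<tau> a b h" "i < n"
        using kempe_ports_here[of ?\<tau> h a i] old[OF a] slot_colouring_Port_less[OF \<sigma> h a] by auto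
      moreover have "i \<noteq> ?p h"
        using \<open>i < n\<close> by simp
      ultimately show ?thesis
        using here by blast
    qed
  qed
  have old_image: "\<sigma> h ` {..<k} \<subseteq> ?\<tau> h ` {..<k + m}" for h
  proof
    fix t assume "t \<in> \<sigma> h ` {..<k}"
    then obtain b where "b < k" "t = ?\<tau> h b"
      using old by auto
    then show "t \<in> ?\<tau> h ` {..<k + m}"
      by auto
  qed
  show ?thesis
  proof (rule slot_colouringI)
    fix h assume h: "h \<in> pverts H"
    have not_both: "?\<tau> h a \<noteq> ?\<tau> h b" if "a < k" "\<not> b < k" for a b
      using slot_colouring_Port_less[OF \<sigma> h that(1)] old[OF that(1)] new[OF that(2)] by fastforce
    show "inj_on (?\<tau> h) {..<k + m}"
    proof (rule inj_onI)
      fix a b assume ab: "a \<in> {..<k + m}" "b \<in> {..<k + m}" "?\<tau> h a = ?\<tau> h b"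
      consider "a < k" "b < k" | "\<not> a < k" "\<not> b < k" | "a < k" "\<not> b < k" | "\<not> a < k" "b < k"
        by blast
      then show "a = b"
      proof cases
        case 1
        then show ?thesis using slot_colouring_inj[OF \<sigma> h] ab old by metis
      next
        case 2
        then show ?thesis using new_inj[OF 2, of "s h"] ab new by simp
      next
        case 3
        then show ?thesis using not_both[of a b] ab by simp
      next
        case 4
        then show ?thesis using not_both[of b a] ab by simp
      qed
    qed
    show "Nbr w \<in> ?\<tau> h ` {..<k + m}" if "(h, w) \<in> parcs H" for w
      using slot_colouring_ex_Nbr[OF \<sigma> h that] old_image[of h] by (metis image_eqI lessThan_iff subsetD)
    show "Port i \<in> ?\<tau> h ` {..<k + m}" if i: "i < n + m" for i
    proof (cases "i < n")
      case True
      then show ?thesis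
        using slot_colouring_ex_Port[OF \<sigma> h True] old_image[of h] by (metis image_eqI lessThan_iff subsetD)
    next
      case False
      \<comment> \<open>The new colour whose shift by \<open>s h\<close> is \<open>i - n\<close> modulo \<open>m\<close>.\<close>
      define b where "b = k + (i - n + (m - s h)) mod m"
      have "m > 0"
        using i False by simp
      then have b: "\<not> b < k" "b < k + m"
        by (simp_all add: b_def)
      have "(b - k + s h) mod m = (i - n + (m - s h) + s h) mod m"
        by (simp add: b_def mod_add_left_eq)
      also have "i - n + (m - s h) + s h = i - n + m"
        using s(1)[OF h] by simp
      also have "(i - n + m) mod m = i - n"
        using i False by (simp only: mod_add_self2) (simp add: less_diff_conv2)
      finally have "?\<tau> h b = Port i"
        using new[OF b(1)] False by simp
      then show ?thesis
        using b(2) by (metis image_eqI lessThan_iff)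
    qed
    show "(h, w) \<in> parcs H \<and> ?\<tau> w b = Nbr h" if "b < k + m" "?\<tau> h b = Nbr w" for b w
    proof -
      have "b < k"
        using that(2) new[of b h] by fastforce
      then show ?thesis
        using slot_colouring_Nbr[OF \<sigma> h] old that(2) by metis
    qed
    show "i < n + m" if "b < k + m" "?\<tau> h b = Port i" for b i
    proof (cases "b < k")
      case True
      then show ?thesis
        using slot_colouring_Port_less[OF \<sigma> h True, of i] old[OF True] that(2) by simp
    next
      case False
      then have "m > 0"
        using that(1) by simp
      then show ?thesis
        using new[OF False] that(2) by auto
    qed
    fix a b assume ab: "a < k + m" "b < k + m" "a \<noteq> b"
    consider "a < k" "b < k" | "\<not> a < k" "\<not> b < k" | "a < k" "\<not> b < k" | "\<not> a < k" "b < k"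
      by blast
    then show "\<exists>i\<in>kempe_ports (pverts H) ?\<tau> a b h. \<exists>j\<in>kempe_ports (pverts H) ?\<tau> a b h. i \<noteq> j"
    proof cases
      case 1
      have "kempe_ports (pverts H) ?\<tau> a b h = kempe_ports (pverts H) \<sigma> a b h"
        using 1 by (simp add: kempe_ports_def kempe_step_def old)
      then show ?thesis
        using slot_colouring_ends[OF \<sigma> h 1 ab(3)] by simp
    next
      case 2
      then have "n + (a - k + s h) mod m \<noteq> n + (b - k + s h) mod m"
        using new_inj[OF 2, of "s h"] ab by auto
      then show ?thesis
        using kempe_ports_here[of ?\<tau> h a] kempe_ports_here[of ?\<tau> h b] new[OF 2(1)] new[OF 2(2)]
          kempe_ports_commute by metis
    next
      case 3
      then show ?thesis using old_new[OF h] ab by blast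
    next
      case 4
      then show ?thesis using old_new[OF h, of b a] ab kempe_ports_commute by metis
    qed
  qed
qed

section \<open>Slot colourings given by tables\<close>

text \<open>
  Slot colourings are carried along graph isomorphisms, so it suffices to exhibit them on graphs
  whose vertices are numbers.
\<close>

lemma slot_colouring_transfer:
  assumes \<sigma>: "slot_colouring K n k \<sigma>" and K: "pair_wf_digraph K"
    and f: "bij_betw f (pverts K) (pverts H)"
    and arcs: "parcs H = (\<lambda>(x, y). (f x, f y)) ` parcs K"
  shows "\<exists>\<tau>. slot_colouring H n k \<tau>"
proof -
  interpret K: pair_wf_digraph K by (rule K)
  define g where "g = the_inv_into (pverts K) f"
  define \<tau> where "\<tau> v b = map_slot f (\<sigma> (g v) b)" for v b
  have inj: "inj_on f (pverts K)" and surj: "pverts H = f ` pverts K"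
    using f by (auto simp: bij_betw_def)
  have \<tau>: "\<tau> (f x) b = map_slot f (\<sigma> x b)" if "x \<in> pverts K" for x b
    using that by (simp add: \<tau>_def g_def the_inv_into_f_f[OF inj])
  have Nbr: "y \<in> pverts K" if "x \<in> pverts K" "b < k" "\<sigma> x b = Nbr y" for x y b
    using slot_colouring_Nbr[OF \<sigma> that] K.in_arcsD2 by blast
  have ports: "kempe_ports (pverts K) \<sigma> a b x \<subseteq> kempe_ports (pverts H) \<tau> a b (f x)"
    if x: "x \<in> pverts K" and ab: "a < k" "b < k" for x a b
  proof
    fix i assume "i \<in> kempe_ports (pverts K) \<sigma> a b x"
    then obtain y where y: "(x, y) \<in> (kempe_step (pverts K) \<sigma> a b)\<^sup>*" "\<sigma> y a = Port i \<or> \<sigma> y b = Port i"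
      by (auto simp: kempe_ports_def)
    have "y \<in> pverts K \<and> (f x, f y) \<in> (kempe_step (pverts H) \<tau> a b)\<^sup>*"
      using y(1)
    proof (induction rule: rtrancl_induct)
      case base
      show ?case using x by simp
    next
      case (step y z)
      then have "z \<in> pverts K" "(f y, f z) \<in> kempe_step (pverts H) \<tau> a b"
        using Nbr ab by (auto simp: kempe_step_def surj \<tau>)
      then show ?case
        using step.IH by (meson rtrancl.rtrancl_into_rtrancl)
    qed
    then show "i \<in> kempe_ports (pverts H) \<tau> a b (f x)"
      using y(2) by (auto simp: kempe_ports_def \<tau>)
  qed
  have "slot_colouring H n k \<tau>"
  proof (rule slot_colouringI)
    fix v assume "v \<in> pverts H"
    then obtain x where x: "x \<in> pverts K" "v = f x"
      using surj by blast
    show "inj_on (\<tau> v) {..<k}"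
    proof (rule inj_onI)
      fix a b assume ab: "a \<in> {..<k}" "b \<in> {..<k}" "\<tau> v a = \<tau> v b"
      then have "\<sigma> x a = \<sigma> x b"
        using x \<tau>[OF x(1)] Nbr[OF x(1)] inj
        by (cases "\<sigma> x a"; cases "\<sigma> x b") (auto dest: inj_onD)
      then show "a = b"
        using slot_colouring_inj[OF \<sigma> x(1)] ab by simp
    qed
    show "Nbr w \<in> \<tau> v ` {..<k}" if "(v, w) \<in> parcs H" for w
    proof -
      from that obtain x' y where y': "(x', y) \<in> parcs K" "v = f x'" "w = f y"
        by (auto simp: arcs)
      then have "x' = x"
        using x inj K.in_arcsD1 by (metis inj_onD)
      with y' have y: "(x, y) \<in> parcs K" "w = f y"
        by simp_all
      from slot_colouring_ex_Nbr[OF \<sigma> x(1) y(1)] obtain b where "b < k" "\<sigma> x b = Nbr y"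
        by blast
      then show ?thesis
        using \<tau>[OF x(1), of b] x(2) y(2) by (metis image_eqI lessThan_iff slot.map(1))
    qed
    show "Port i \<in> \<tau> v ` {..<k}" if "i < n" for i
    proof -
      from slot_colouring_ex_Port[OF \<sigma> x(1) that] obtain b where "b < k" "\<sigma> x b = Port i"
        by blast
      then show ?thesis
        using \<tau>[OF x(1), of b] x(2) by (metis image_eqI lessThan_iff slot.map(2))
    qed
    show "(v, w) \<in> parcs H \<and> \<tau> w b = Nbr v" if b: "b < k" and "\<tau> v b = Nbr w" for b w
    proof -
      have "\<exists>y. \<sigma> x b = Nbr y \<and> w = f y"
        using that(2) x(2) \<tau>[OF x(1), of b] by (cases "\<sigma> x b") auto
      then obtain y where y: "\<sigma> x b = Nbr y" "w = f y"
        by blast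
      then show ?thesis
        using slot_colouring_Nbr[OF \<sigma> x(1) b y(1)] \<tau>[OF Nbr[OF x(1) b y(1)], of b] x(2)
        by (auto simp: arcs)
    qed
    show "i < n" if "b < k" "\<tau> v b = Port i" for b i
      using slot_colouring_Port_less[OF \<sigma> x(1) that(1), of i] that(2) x(2) \<tau>[OF x(1), of b]
      by (cases "\<sigma> x b") auto
    show "\<exists>i\<in>kempe_ports (pverts H) \<tau> a b v. \<exists>j\<in>kempe_ports (pverts H) \<tau> a b v. i \<noteq> j"
      if "a < k" "b < k" "a \<noteq> b" for a b
      using slot_colouring_ends[OF \<sigma> x(1) that] ports[OF x(1) that(1,2)] x(2) by blast
  qed
  then show ?thesis
    by blast
qed

definition nat_graph :: "nat \<Rightarrow> (nat \<Rightarrow> nat \<Rightarrow> bool) \<Rightarrow> nat pair_pre_digraph" where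
  "nat_graph N adj = \<lparr>pverts = {..<N}, parcs = {(i, j). i < N \<and> j < N \<and> adj i j}\<rparr>"

lemma pair_wf_digraph_nat_graph: "pair_wf_digraph (nat_graph N adj)"
  by unfold_locales (auto simp: nat_graph_def)

text \<open>
  Follows the Kempe chain that starts at \<open>h\<close> with colour \<open>a\<close>, for at most \<open>r\<close> edges, up to the
  first port. If the fuel \<open>r\<close> does not suffice, the result is of the form \<open>Nbr w\<close> or a correct port.
\<close>

primrec kempe_end :: "nat slot list list \<Rightarrow> nat \<Rightarrow> nat \<Rightarrow> nat \<Rightarrow> nat \<Rightarrow> nat slot" where
  "kempe_end T 0 a b h = T ! h ! a"
| "kempe_end T (Suc r) a b h = (case T ! h ! a of Nbr w \<Rightarrow> kempe_end T r b a w | Port i \<Rightarrow> Port i)"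

fun distinct_ports :: "nat slot \<Rightarrow> nat slot \<Rightarrow> bool" where
  "distinct_ports (Port i) (Port j) = (i \<noteq> j)"
| "distinct_ports _ _ = False"

text \<open>
  An executable form of the conditions of \<^const>\<open>slot_colouring\<close> at the vertex \<open>h\<close>, where entry \<open>b\<close>
  of row \<open>h\<close> is the slot of colour \<open>b\<close>. The chain through \<open>h\<close> is followed in both directions; its
  length is bounded by the number of vertices.
\<close>

definition valid_row ::
  "(nat \<Rightarrow> nat \<Rightarrow> bool) \<Rightarrow> nat \<Rightarrow> nat \<Rightarrow> nat slot list list \<Rightarrow> nat \<Rightarrow> bool" where
  "valid_row adj n k T h \<longleftrightarrow>
    distinct (T ! h) \<and> length (T ! h) = k \<and>
    (\<forall>w<length T. adj h w \<longrightarrow> Nbr w \<in> set (T ! h)) \<and>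
    (\<forall>i<n. Port i \<in> set (T ! h)) \<and>
    (\<forall>b<k. case T ! h ! b of
        Nbr w \<Rightarrow> w < length T \<and> adj h w \<and> T ! w ! b = Nbr h
      | Port i \<Rightarrow> i < n) \<and>
    (\<forall>a<k. \<forall>b<k. a \<noteq> b \<longrightarrow>
      distinct_ports (kempe_end T (length T) a b h) (kempe_end T (length T) b a h))"

lemma kempe_end_in_ports:
  assumes "\<And>h. h < length T \<Longrightarrow> valid_row adj n k T h"
    and "h < length T" "a < k" "b < k" "kempe_end T r a b h = Port i"
  shows "i \<in> kempe_ports {..<length T} (\<lambda>h b. T ! h ! b) a b h"
  using assms(2-)
proof (induction r arbitrary: a b h)
  case 0
  then show ?case
    by (simp add: kempe_ports_here)
next
  case (Suc r)
  show ?case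
  proof (cases "T ! h ! a")
    case (Nbr w)
    have "w < length T"
      using assms(1)[OF Suc.prems(1)] Nbr Suc.prems(2) by (auto simp: valid_row_def)
    then have "i \<in> kempe_ports {..<length T} (\<lambda>h b. T ! h ! b) b a w"
      using Suc Nbr by simp
    then show ?thesis
      using Suc.prems(1) Nbr kempe_ports_step[of h "{..<length T}" "\<lambda>h b. T ! h ! b" a w i b]
      by (simp add: kempe_ports_commute)
  next
    case (Port j)
    then show ?thesis
      using Suc.prems(4) by (simp add: kempe_ports_here)
  qed
qed

lemma slot_colouring_of_table:
  assumes "\<forall>h<length T. valid_row adj n k T h"
  shows "slot_colouring (nat_graph (length T) adj) n k (\<lambda>h b. T ! h ! b)"
proof (rule slot_colouringI)
  fix h assume "h \<in> pverts (nat_graph (length T) adj)"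
  then have h: "h < length T"
    by (simp add: nat_graph_def)
  then have row: "distinct (T ! h)" "length (T ! h) = k"
    "\<And>w. w < length T \<Longrightarrow> adj h w \<Longrightarrow> Nbr w \<in> set (T ! h)"
    "\<And>i. i < n \<Longrightarrow> Port i \<in> set (T ! h)"
    "\<And>b. b < k \<Longrightarrow> case T ! h ! b of
        Nbr w \<Rightarrow> w < length T \<and> adj h w \<and> T ! w ! b = Nbr h
      | Port i \<Rightarrow> i < n"
    "\<And>a b. a < k \<Longrightarrow> b < k \<Longrightarrow> a \<noteq> b \<Longrightarrow>
      distinct_ports (kempe_end T (length T) a b h) (kempe_end T (length T) b a h)"
    using assms by (simp_all add: valid_row_def)
  have set_row: "set (T ! h) = (\<lambda>b. T ! h ! b) ` {..<k}"
    using row(2) by (auto simp: set_conv_nth)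
  show "inj_on (\<lambda>b. T ! h ! b) {..<k}"
    using row(1,2) by (simp add: inj_on_nth)
  show "Nbr w \<in> (\<lambda>b. T ! h ! b) ` {..<k}" if "(h, w) \<in> parcs (nat_graph (length T) adj)" for w
    using row(3)[of w] that set_row by (simp add: nat_graph_def)
  show "Port i \<in> (\<lambda>b. T ! h ! b) ` {..<k}" if "i < n" for i
    using row(4)[OF that] set_row by simp
  show "(h, w) \<in> parcs (nat_graph (length T) adj) \<and> T ! w ! b = Nbr h"
    if "b < k" "T ! h ! b = Nbr w" for b w
    using row(5)[OF that(1)] that(2) h by (simp add: nat_graph_def)
  show "i < n" if "b < k" "T ! h ! b = Port i" for b i
    using row(5)[OF that(1)] that(2) by simp
  show "\<exists>i\<in>kempe_ports (pverts (nat_graph (length T) adj)) (\<lambda>h b. T ! h ! b) a b h.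
      \<exists>j\<in>kempe_ports (pverts (nat_graph (length T) adj)) (\<lambda>h b. T ! h ! b) a b h. i \<noteq> j"
    if ab: "a < k" "b < k" "a \<noteq> b" for a b
  proof -
    obtain i j where "kempe_end T (length T) a b h = Port i" "kempe_end T (length T) b a h = Port j" "i \<noteq> j"
      using row(6)[OF ab] by (auto elim: distinct_ports.elims)
    moreover from this have "i \<in> kempe_ports {..<length T} (\<lambda>h b. T ! h ! b) a b h"
      and "j \<in> kempe_ports {..<length T} (\<lambda>h b. T ! h ! b) b a h"
      using kempe_end_in_ports[of T adj n k h] assms h ab by blast+
    ultimately show ?thesis
      using kempe_ports_commute[of "{..<length T}" "\<lambda>h b. T ! h ! b" b a h]
      by (auto simp: nat_graph_def)
  qed
qed

section \<open>Slot colourings of the Petersen graph and of \<open>K\<^sub>4\<close>\<close>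

text \<open>
  In the tables for the Petersen graph, the vertices \<open>0, \<dots>, 4\<close> form the outer pentagon, the vertices
  \<open>5, \<dots>, 9\<close> form the inner pentagram, and the vertex \<open>i\<close> is joined to \<open>i + 5\<close>. The first two tables
  are invariant under the rotation of order five: it advances the colours \<open>0, \<dots>, 4\<close> cyclically, and
  fixes the colour \<open>5\<close> of the spokes in the second table.
\<close>

definition petersen_table_2 :: "nat slot list list" where
  "petersen_table_2 =
  [[Nbr 1, Nbr 5, Port 0, Port 1, Nbr 4],
   [Nbr 0, Nbr 2, Nbr 6, Port 0, Port 1],
   [Port 1, Nbr 1, Nbr 3, Nbr 7, Port 0],
   [Port 0, Port 1, Nbr 2, Nbr 4, Nbr 8],
   [Nbr 9, Port 0, Port 1, Nbr 3, Nbr 0],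
   [Nbr 8, Nbr 0, Nbr 7, Port 0, Port 1],
   [Port 1, Nbr 9, Nbr 1, Nbr 8, Port 0],
   [Port 0, Port 1, Nbr 5, Nbr 2, Nbr 9],
   [Nbr 5, Port 0, Port 1, Nbr 6, Nbr 3],
   [Nbr 4, Nbr 6, Port 0, Port 1, Nbr 7]]"

definition petersen_table_3 :: "nat slot list list" where
  "petersen_table_3 =
  [[Nbr 1, Port 0, Port 1, Port 2, Nbr 4, Nbr 5],
   [Nbr 0, Nbr 2, Port 0, Port 1, Port 2, Nbr 6],
   [Port 2, Nbr 1, Nbr 3, Port 0, Port 1, Nbr 7],
   [Port 1, Port 2, Nbr 2, Nbr 4, Port 0, Nbr 8],
   [Port 0, Port 1, Port 2, Nbr 3, Nbr 0, Nbr 9],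
   [Nbr 7, Port 2, Port 0, Nbr 8, Port 1, Nbr 0],
   [Port 1, Nbr 8, Port 2, Port 0, Nbr 9, Nbr 1],
   [Nbr 5, Port 1, Nbr 9, Port 2, Port 0, Nbr 2],
   [Port 0, Nbr 6, Port 1, Nbr 5, Port 2, Nbr 3],
   [Port 2, Port 0, Nbr 7, Port 1, Nbr 6, Nbr 4]]"

definition petersen_table_4 :: "nat slot list list" where
  "petersen_table_4 =
  [[Nbr 4, Nbr 1, Port 3, Port 2, Port 1, Nbr 5, Port 0],
   [Port 1, Nbr 0, Port 2, Port 0, Nbr 6, Nbr 2, Port 3],
   [Nbr 3, Port 2, Port 0, Port 3, Nbr 7, Nbr 1, Port 1],
   [Nbr 2, Port 1, Port 3, Nbr 4, Port 0, Nbr 8, Port 2],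
   [Nbr 0, Port 0, Nbr 9, Nbr 3, Port 2, Port 3, Port 1],
   [Nbr 7, Port 3, Port 1, Port 0, Port 2, Nbr 0, Nbr 8],
   [Port 2, Port 3, Port 0, Nbr 8, Nbr 1, Nbr 9, Port 1],
   [Nbr 5, Nbr 9, Port 3, Port 2, Nbr 2, Port 1, Port 0],
   [Port 3, Port 0, Port 2, Nbr 6, Port 1, Nbr 3, Nbr 5],
   [Port 0, Nbr 7, Nbr 4, Port 1, Port 3, Nbr 6, Port 2]]"

definition k4_table_2 :: "nat slot list list" where
  "k4_table_2 =
  [[Nbr 2, Nbr 3, Port 0, Port 1, Nbr 1],
   [Port 0, Port 1, Nbr 3, Nbr 2, Nbr 0],
   [Nbr 0, Port 0, Port 1, Nbr 1, Nbr 3],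
   [Port 1, Nbr 0, Nbr 1, Port 0, Nbr 2]]"

definition k4_table_4 :: "nat slot list list" where
  "k4_table_4 =
  [[Port 0, Port 1, Port 3, Port 2, Nbr 3, Nbr 1, Nbr 2],
   [Port 3, Nbr 3, Port 2, Nbr 2, Port 0, Nbr 0, Port 1],
   [Port 1, Port 3, Nbr 3, Nbr 1, Port 2, Port 0, Nbr 0],
   [Port 2, Nbr 1, Nbr 2, Port 1, Nbr 0, Port 3, Port 0]]"

text \<open>
  The vertex of the Kneser graph that corresponds to each number.
\<close>

definition petersen_pairs :: "nat set list" where
  "petersen_pairs = [{0, 1}, {2, 3}, {4, 0}, {1, 2}, {3, 4}, {2, 4}, {4, 1}, {1, 3}, {3, 0}, {0, 2}]"

definition petersen_adj :: "nat \<Rightarrow> nat \<Rightarrow> bool" where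
  "petersen_adj i j \<longleftrightarrow> petersen_pairs ! i \<inter> petersen_pairs ! j = {}"

lemma petersen_tables:
  "\<forall>h<length petersen_table_2. valid_row petersen_adj 2 5 petersen_table_2 h"
  "\<forall>h<length petersen_table_3. valid_row petersen_adj 3 6 petersen_table_3 h"
  "\<forall>h<length petersen_table_4. valid_row petersen_adj 4 7 petersen_table_4 h"
  by code_simp+

lemma k4_tables:
  "\<forall>h<length k4_table_2. valid_row (\<noteq>) 2 5 k4_table_2 h"
  "\<forall>h<length k4_table_4. valid_row (\<noteq>) 4 7 k4_table_4 h"
  by code_simp+

definition petersen_vertex_colour :: "nat \<Rightarrow> nat" where
  "petersen_vertex_colour i = [0, 1, 0, 1, 2, 1, 2, 2, 0, 0] ! i"

lemma petersen_vertex_colour_proper: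
  "\<forall>i<10. petersen_vertex_colour i < 3 \<and>
    (\<forall>j<10. petersen_adj i j \<longrightarrow> petersen_vertex_colour i \<noteq> petersen_vertex_colour j)"
  by code_simp

text \<open>
  Since the Petersen graph is 3-chromatic, at least three ports can be added by shifting. Starting
  from two ports this yields every number of ports from five on; three and four ports have tables
  of their own.
\<close>

lemma petersen_slot_colouring_nat:
  assumes "2 \<le> n"
  shows "\<exists>\<sigma>. slot_colouring (nat_graph 10 petersen_adj) n (n + 3) \<sigma>"
proof -
  have len: "length petersen_table_2 = 10" "length petersen_table_3 = 10" "length petersen_table_4 = 10"
    by (simp_all add: petersen_table_2_def petersen_table_3_def petersen_table_4_def)
  note tables = petersen_tables[THEN slot_colouring_of_table, unfolded len]
  consider "n = 2" | "n = 3" | "n = 4" | "5 \<le> n"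
    using assms by linarith
  then show ?thesis
  proof cases
    case 1
    then show ?thesis using tables(1) by auto
  next
    case 2
    then show ?thesis using tables(2) by auto
  next
    case 3
    then show ?thesis using tables(3) by auto
  next
    case 4
    have "slot_colouring (nat_graph 10 petersen_adj) (2 + (n - 2)) (5 + (n - 2))
        (add_shifted_ports 2 5 (n - 2) petersen_vertex_colour (\<lambda>h b. petersen_table_2 ! h ! b))"
      using petersen_vertex_colour_proper 4
      by (intro slot_colouring_add_shifted_ports tables(1)) (fastforce simp: nat_graph_def)+
    moreover have "2 + (n - 2) = n" "5 + (n - 2) = n + 3"
      using 4 by simp_all
    ultimately show ?thesis
      by metis
  qed
qed

text \<open>
  In \<open>K\<^sub>4\<close> the shifts need at least four new ports, so they lead from two ports to six and more. The
  remaining values one, three and five can be skipped: for \<open>K\<^sub>4\<close> the claimed bound is one larger than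
  for the Petersen graph, so a colouring of \<open>G\<close> with \<open>n\<close> colours can be combined with \<open>n + 1\<close> ports.
\<close>

lemma k4_slot_colouring_nat:
  assumes "n = 2 \<or> n = 4 \<or> 6 \<le> n"
  shows "\<exists>\<sigma>. slot_colouring (nat_graph 4 (\<noteq>)) n (n + 3) \<sigma>"
proof -
  have len: "length k4_table_2 = 4" "length k4_table_4 = 4"
    by (simp_all add: k4_table_2_def k4_table_4_def)
  note tables = k4_tables[THEN slot_colouring_of_table, unfolded len]
  from assms consider "n = 2" | "n = 4" | "6 \<le> n"
    by blast
  then show ?thesis
  proof cases
    case 1
    then show ?thesis using tables(1) by auto
  next
    case 2
    then show ?thesis using tables(2) by auto
  next
    case 3
    have "slot_colouring (nat_graph 4 (\<noteq>)) (2 + (n - 2)) (5 + (n - 2))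
        (add_shifted_ports 2 5 (n - 2) id (\<lambda>h b. k4_table_2 ! h ! b))"
      using 3 by (intro slot_colouring_add_shifted_ports tables(1)) (auto simp: nat_graph_def)
    moreover have "2 + (n - 2) = n" "5 + (n - 2) = n + 3"
      using 3 by simp_all
    ultimately show ?thesis
      by metis
  qed
qed

lemma bij_betw_petersen_pairs:
  "bij_betw ((!) petersen_pairs) {..<10} (pverts petersen_graph)"
proof (rule bij_betw_nth)
  show "distinct petersen_pairs"
    by (simp add: petersen_pairs_def doubleton_eq_iff)
  show "{..<10} = {..<length petersen_pairs}"
    by (simp add: petersen_pairs_def)
  have "A \<in> set petersen_pairs" if sub: "A \<subseteq> {0..<5}" and "card A = 2" for A
  proof -
    from that(2) obtain x y where A: "A = {x, y}" "x \<noteq> y"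
      by (auto simp: card_2_iff)
    then have "x \<in> {0, 1, 2, 3, 4}" "y \<in> {0, 1, 2, 3, 4}"
      using sub by auto
    then show ?thesis
      using A by (auto simp: petersen_pairs_def doubleton_eq_iff)
  qed
  moreover have "\<forall>A\<in>set petersen_pairs. A \<subseteq> {0..<5} \<and> card A = 2"
    by (simp add: petersen_pairs_def)
  ultimately show "pverts petersen_graph = set petersen_pairs"
    by (simp add: petersen_graph_def set_eq_iff) blast
qed

lemma petersen_slot_colouring:
  assumes "2 \<le> n"
  shows "\<exists>\<sigma>. slot_colouring petersen_graph n (n + 3) \<sigma>"
proof -
  let ?f = "(!) petersen_pairs"
  obtain \<sigma> where \<sigma>: "slot_colouring (nat_graph 10 petersen_adj) n (n + 3) \<sigma>"
    using petersen_slot_colouring_nat[OF assms] by blast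
  have verts: "pverts petersen_graph = ?f ` {..<10}"
    using bij_betw_petersen_pairs by (simp add: bij_betw_def)
  have "parcs petersen_graph =
      {(A, B). A \<in> pverts petersen_graph \<and> B \<in> pverts petersen_graph \<and> A \<inter> B = {}}"
    by (auto simp: petersen_graph_def)
  also have "\<dots> = (\<lambda>(x, y). (?f x, ?f y)) ` parcs (nat_graph 10 petersen_adj)"
    unfolding verts by (auto simp: nat_graph_def petersen_adj_def image_iff)
  finally show ?thesis
    by (intro slot_colouring_transfer[OF \<sigma> pair_wf_digraph_nat_graph])
      (simp_all add: nat_graph_def bij_betw_petersen_pairs)
qed

lemma is_petersen_graphE:
  assumes "is_petersen_graph H"
  obtains f where "bij_betw f (pverts petersen_graph) (pverts H)"
    "parcs H = (\<lambda>(x, y). (f x, f y)) ` parcs petersen_graph"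
proof -
  obtain iso where iso: "pre_digraph.digraph_isomorphism (with_proj petersen_graph) iso"
    "with_proj H = app_iso iso (with_proj petersen_graph)"
    using assms unfolding is_petersen_graph_def digraph_iso_def by blast
  have ends: "iso_tail iso = fst" "iso_head iso = snd"
    using arg_cong[OF iso(2), of tail] arg_cong[OF iso(2), of head] by simp_all
  have verts: "pverts H = iso_verts iso ` pverts petersen_graph"
    using arg_cong[OF iso(2), of verts] by simp
  have "iso_arcs iso (x, y) = (iso_verts iso x, iso_verts iso y)" if "(x, y) \<in> parcs petersen_graph" for x y
    using iso(1) that ends by (force simp: pre_digraph.digraph_isomorphism_def prod_eq_iff)
  then have "parcs H = (\<lambda>(x, y). (iso_verts iso x, iso_verts iso y)) ` parcs petersen_graph"
    using arg_cong[OF iso(2), of arcs] by (force simp: image_iff)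
  moreover have "inj_on (iso_verts iso) (pverts petersen_graph)"
    using iso(1) by (simp add: pre_digraph.digraph_isomorphism_def)
  ultimately show ?thesis
    using that[of "iso_verts iso"] verts by (simp add: bij_betw_def)
qed

lemma pair_graph_if_petersen:
  assumes "is_petersen_graph H"
  shows "pair_graph H"
proof -
  interpret P: pair_graph petersen_graph
    by (rule pair_graph_petersen_graph)
  obtain f where f: "bij_betw f (pverts petersen_graph) (pverts H)"
    and arcs: "parcs H = (\<lambda>(x, y). (f x, f y)) ` parcs petersen_graph"
    using is_petersen_graphE[OF assms] .
  have verts: "pverts H = f ` pverts petersen_graph" and inj: "inj_on f (pverts petersen_graph)"
    using f by (auto simp: bij_betw_def)
  show ?thesis
  proof unfold_locales
    show "fst e \<in> pverts H" if "e \<in> parcs H" for e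
      using that by (auto simp: arcs verts dest: P.wellformed')
    show "snd e \<in> pverts H" if "e \<in> parcs H" for e
      using that by (auto simp: arcs verts dest: P.wellformed')
    show "finite (pverts H)"
      using verts P.pair_finite_verts by simp
    show "finite (parcs H)"
      using arcs P.pair_finite_arcs by simp
    show "symmetric (with_proj H)"
      by (force simp: symmetric_def sym_def arcs dest: P.arcs_symmetric)
    show "fst e \<noteq> snd e" if "e \<in> parcs H" for e
    proof -
      from that obtain x y where e: "e = (f x, f y)" "(x, y) \<in> parcs petersen_graph"
        by (auto simp: arcs)
      then have "x \<noteq> y" "x \<in> pverts petersen_graph" "y \<in> pverts petersen_graph"
        using P.no_loops' P.wellformed' by blast+
      then show ?thesis
        using e inj by (simp add: inj_on_eq_iff)
    qed
  qed
qed

lemma is_petersen_slot_colouring: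
  assumes "is_petersen_graph H" "2 \<le> n"
  shows "\<exists>\<sigma>. slot_colouring H n (n + 3) \<sigma>"
proof -
  interpret P: pair_graph petersen_graph
    by (rule pair_graph_petersen_graph)
  obtain \<tau> where \<tau>: "slot_colouring petersen_graph n (n + 3) \<tau>"
    using petersen_slot_colouring[OF assms(2)] by blast
  obtain f where f: "bij_betw f (pverts petersen_graph) (pverts H)"
    "parcs H = (\<lambda>(x, y). (f x, f y)) ` parcs petersen_graph"
    using is_petersen_graphE[OF assms(1)] .
  show ?thesis
    by (rule slot_colouring_transfer[OF \<tau> P.pair_wf_digraph f])
qed

lemma k4_slot_colouring:
  assumes H: "complete_digraph 4 (with_proj H)" and n: "n = 2 \<or> n = 4 \<or> 6 \<le> n"
  shows "\<exists>\<sigma>. slot_colouring H n (n + 3) \<sigma>"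
proof -
  obtain \<sigma> where \<sigma>: "slot_colouring (nat_graph 4 (\<noteq>)) n (n + 3) \<sigma>"
    using k4_slot_colouring_nat[OF n] by blast
  have fin: "finite (pverts H)" and card: "card (pverts H) = 4"
    and arcs: "parcs H = {(u, v). (u, v) \<in> pverts H \<times> pverts H \<and> u \<noteq> v}"
    using H by (simp_all add: complete_digraph_pair_def)
  obtain f where f: "bij_betw f {..<4::nat} (pverts H)"
    using ex_bij_betw_nat_finite[OF fin] by (auto simp: card atLeast0LessThan)
  then have inj: "inj_on f {..<4}" and verts: "pverts H = f ` {..<4}"
    by (auto simp: bij_betw_def)
  have "parcs H = (\<lambda>(x, y). (f x, f y)) ` parcs (nat_graph 4 (\<noteq>))"
    unfolding arcs verts using inj by (auto simp: nat_graph_def image_iff inj_on_eq_iff)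
  then show ?thesis
    using f by (intro slot_colouring_transfer[OF \<sigma> pair_wf_digraph_nat_graph])
      (simp_all add: nat_graph_def)
qed

section \<open>Lower bounds for the factor \<open>H\<close>\<close>

text \<open>
  With only as many colours as the minimum degree, every vertex would see every colour, and the
  whole graph would be a core for any two of the colours.
\<close>

lemma degree_less_card_colours:
  assumes G: "pair_graph G" and c: "acyclic_edge_colouring G c" and ne: "pverts G \<noteq> {}"
    and d: "2 \<le> d" "\<And>v. v \<in> pverts G \<Longrightarrow> d \<le> card {w. (v, w) \<in> parcs G}"
  shows "d < card (c ` uedges G)"
proof (rule ccontr)
  interpret pair_graph G by (rule G)
  assume few: "\<not> d < card (c ` uedges G)"
  have fin: "finite (c ` uedges G)"
    using finite_uedges[OF G] by simp
  have inj: "inj_on (\<lambda>w. c {v, w}) {w. (v, w) \<in> parcs G}" for v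
    using c by (auto simp: acyclic_edge_colouring_def intro!: inj_onI dest: proper_edge_colouringD)
  have sub: "(\<lambda>w. c {v, w}) ` {w. (v, w) \<in> parcs G} \<subseteq> c ` uedges G" for v
    by (auto simp: in_uedges)
  \<comment> \<open>With at most \<open>d\<close> colours, the edges at any vertex exhaust all of them.\<close>
  have all: "(\<lambda>w. c {v, w}) ` {w. (v, w) \<in> parcs G} = c ` uedges G" if v: "v \<in> pverts G" for v
    using d(2)[OF v] few by (intro card_seteq[OF fin sub]) (simp add: card_image[OF inj])
  obtain v where v: "v \<in> pverts G"
    using ne by blast
  have "card {w. (v, w) \<in> parcs G} \<le> card (c ` uedges G)"
    using card_mono[OF fin sub] by (simp add: card_image[OF inj])
  then have "2 \<le> card (c ` uedges G)"
    using d(1) d(2)[OF v] by linarith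
  then obtain C where "C \<subseteq> c ` uedges G" "card C = 2"
    by (metis obtain_subset_with_card_n)
  then obtain a b where ab: "a \<noteq> b" "a \<in> c ` uedges G" "b \<in> c ` uedges G"
    by (auto simp: card_2_iff)
  have "\<exists>w\<in>pverts G. (v, w) \<in> parcs G \<and> c {v, w} = e" if "v \<in> pverts G" "e \<in> c ` uedges G" for v e
  proof -
    have "e \<in> (\<lambda>w. c {v, w}) ` {w. (v, w) \<in> parcs G}"
      using all[OF that(1)] that(2) by simp
    then show ?thesis
      using in_arcsD2 by auto
  qed
  then have "two_coloured_core G c a b (pverts G)"
    using ab ne unfolding two_coloured_core_def by blast
  then show False
    using acyclic_imp_no_core[OF G c ab(1)] by blast
qed

text \<open>
  A vertex spends at most \<open>n\<close> of its \<open>k\<close> slots on ports. This reads off the degrees of a graph from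
  a slot colouring of it.
\<close>

lemma slot_colouring_degree:
  assumes H: "pair_graph H" and \<sigma>: "slot_colouring H n k \<sigma>" and h: "h \<in> pverts H"
  shows "k - n \<le> card {w. (h, w) \<in> parcs H}"
proof -
  interpret pair_graph H by (rule H)
  let ?N = "{w. (h, w) \<in> parcs H}"
  have "?N \<subseteq> pverts H"
    using in_arcsD2 by blast
  then have fin: "finite ?N"
    using pair_finite_verts finite_subset by blast
  have "\<sigma> h ` {..<k} \<subseteq> Nbr ` ?N \<union> Port ` {..<n}"
  proof
    fix t assume "t \<in> \<sigma> h ` {..<k}"
    then obtain b where b: "b < k" "t = \<sigma> h b"
      by auto
    show "t \<in> Nbr ` ?N \<union> Port ` {..<n}"
      using slot_colouring_Nbr[OF \<sigma> h b(1) b(2)[symmetric, THEN trans]]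
        slot_colouring_Port_less[OF \<sigma> h b(1) b(2)[symmetric, THEN trans]]
      by (cases t) auto
  qed
  then have "card (\<sigma> h ` {..<k}) \<le> card (Nbr ` ?N \<union> Port ` {..<n})"
    by (rule card_mono[rotated]) (simp add: fin)
  also have "\<dots> \<le> card ?N + n"
    by (rule order_trans[OF card_Un_le add_mono]) (simp_all add: fin card_image inj_on_def)
  also have "card (\<sigma> h ` {..<k}) = k"
    using slot_colouring_inj[OF \<sigma> h] by (simp add: card_image inj_on_def)
  finally show ?thesis
    by simp
qed

lemma petersen_index_ge_4:
  assumes H: "is_petersen_graph H"
  shows "4 \<le> acyclic_chromatic_index H"
proof (rule le_acyclic_chromatic_indexI[OF pair_graph_if_petersen[OF H]])
  fix c assume c: "acyclic_edge_colouring H c"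
  obtain f where f: "bij_betw f (pverts petersen_graph) (pverts H)"
    using is_petersen_graphE[OF H] .
  obtain \<sigma> where \<sigma>: "slot_colouring H 2 5 \<sigma>"
    using is_petersen_slot_colouring[OF H, of 2] by auto
  have "pverts H \<noteq> {}"
    using bij_betw_same_card[OF f] bij_betw_same_card[OF bij_betw_petersen_pairs] by auto
  then have "3 < card (c ` uedges H)"
    using slot_colouring_degree[OF pair_graph_if_petersen[OF H] \<sigma>]
    by (intro degree_less_card_colours[OF pair_graph_if_petersen[OF H] c]) simp_all
  then show "4 \<le> card (c ` uedges H)"
    by simp
qed

text \<open>
  The six edges of \<open>K\<^sub>4\<close> split into three perfect matchings. Two monochromatic perfect matchings would
  form a two-coloured 4-cycle, so at least two matchings use two colours each. These four colours are
  distinct, since edges of different matchings are adjacent, and the edges of the third matching are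
  adjacent to all four edges, so they need a fifth colour.
\<close>

lemma k4_index_ge_5:
  assumes H: "complete_digraph 4 (with_proj H)"
  shows "5 \<le> acyclic_chromatic_index H"
proof -
  have G: "pair_graph H"
    using H pair_graphI_graph by (auto simp: complete_digraph_def)
  have fin: "finite (pverts H)" and card: "card (pverts H) = 4"
    and arcs: "parcs H = {(u, v). (u, v) \<in> pverts H \<times> pverts H \<and> u \<noteq> v}"
    using H by (simp_all add: complete_digraph_pair_def)
  show ?thesis
  proof (rule le_acyclic_chromatic_indexI[OF G])
    fix c assume c: "acyclic_edge_colouring H c"
    have adj: "c {u, v} \<noteq> c {u, w}"
      if "distinct [u, v, w]" "{u, v, w} \<subseteq> pverts H" for u v w
      using proper_edge_colouringD[of H c u v w] c that
      by (auto simp: arcs acyclic_edge_colouring_def)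
    have one_monochromatic: "\<not> (c {w, x} = c {y, z} \<and> c {w, y} = c {x, z})"
      if d: "distinct [w, x, y, z]" and V: "pverts H = {w, x, y, z}" for w x y z
    proof
      assume eq: "c {w, x} = c {y, z} \<and> c {w, y} = c {x, z}"
      have "two_coloured_core H c (c {w, x}) (c {w, y}) (pverts H)"
        using d eq unfolding two_coloured_core_def V arcs
        by (auto simp: insert_commute)
      moreover have "c {w, x} \<noteq> c {w, y}"
        using adj[of w x y] d V by auto
      ultimately show False
        using acyclic_imp_no_core[OF G c] by blast
    qed
    have two_bichromatic: "5 \<le> card (c ` uedges H)"
      if d: "distinct [w, x, y, z]" and V: "pverts H = {w, x, y, z}"
        and ne: "c {w, x} \<noteq> c {y, z}" "c {w, y} \<noteq> c {x, z}" for w x y z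
    proof -
      have "distinct [c {w, x}, c {y, z}, c {w, y}, c {x, z}, c {w, z}]"
        using ne d V adj[of w x y] adj[of x w z] adj[of w x z] adj[of y z w] adj[of z y x] adj[of z y w]
          adj[of w y z] adj[of z x w]
        by (auto simp: insert_commute)
      then have "card (set [c {w, x}, c {y, z}, c {w, y}, c {x, z}, c {w, z}]) = 5"
        by (subst distinct_card) simp_all
      moreover have "{w, x} \<in> uedges H" "{y, z} \<in> uedges H" "{w, y} \<in> uedges H" "{x, z} \<in> uedges H"
        "{w, z} \<in> uedges H"
        using d by (auto intro!: in_uedges simp: arcs V)
      then have "set [c {w, x}, c {y, z}, c {w, y}, c {x, z}, c {w, z}] \<subseteq> c ` uedges H"
        by auto
      ultimately show ?thesis
        using card_mono[of "c ` uedges H"] finite_uedges[OF G] by (metis finite_imageI)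
    qed
    obtain f where f: "bij_betw f {..<4::nat} (pverts H)"
      using ex_bij_betw_nat_finite[OF fin] by (auto simp: card atLeast0LessThan)
    define w x y z where "w = f 0" and "x = f 1" and "y = f 2" and "z = f 3"
    have d: "distinct [w, x, y, z]"
      using f by (auto simp: bij_betw_def w_def x_def y_def z_def dest!: inj_onD)
    have "{..<4} = {0, 1, 2, 3::nat}"
      by auto
    then have V: "pverts H = {w, x, y, z}"
      using f by (auto simp: bij_betw_def w_def x_def y_def z_def)
    show "5 \<le> card (c ` uedges H)"
    proof (cases "c {w, x} = c {y, z}")
      case True
      then have "c {w, y} \<noteq> c {x, z}"
        using one_monochromatic[of w x y z] d V by auto
      moreover have "c {w, z} \<noteq> c {y, x}"
        using one_monochromatic[of w x z y] True d V by (auto simp: insert_commute)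
      ultimately show ?thesis
        using two_bichromatic[of w y z x] d V by (auto simp: insert_commute)
    next
      case ne: False
      show ?thesis
      proof (cases "c {w, y} = c {x, z}")
        case True
        then have "c {w, z} \<noteq> c {x, y}"
          using one_monochromatic[of w y z x] d V by (auto simp: insert_commute)
        then show ?thesis
          using two_bichromatic[of w x z y] ne d V by (auto simp: insert_commute)
      next
        case False
        then show ?thesis
          using two_bichromatic[of w x y z] ne d V by auto
      qed
    qed
  qed
qed

section \<open>Connected graphs with small acyclic chromatic index\<close>

lemma connected_leaving_arc:
  assumes G: "pair_graph G" and conn: "connected (with_proj G)"
    and A: "A \<subset> pverts G" "A \<noteq> {}"
  obtains x y where "(x, y) \<in> parcs G" "x \<in> A" "y \<notin> A"
proof (rule ccontr)
  interpret pair_graph G by (rule G)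
  assume "\<not> thesis"
  then have closed: "y \<in> A" if "(x, y) \<in> parcs G" "x \<in> A" for x y
    using that \<open>\<And>x y. (x, y) \<in> parcs G \<Longrightarrow> x \<in> A \<Longrightarrow> y \<notin> A \<Longrightarrow> thesis\<close> by blast
  obtain u v where uv: "u \<in> A" "v \<in> pverts G" "v \<notin> A"
    using A by blast
  have "u \<rightarrow>\<^sup>*\<^bsub>with_proj G\<^esub> v"
    using symmetric_connected_imp_strongly_connected[OF pair_sym_arcs conn] uv A(1)
    by (auto simp: strongly_connected_def)
  then have "v \<in> A"
    by (induction rule: reachable_induct) (use uv closed in auto)
  then show False
    using uv by simp
qed

lemma index_ge_1:
  assumes G: "pair_graph G" and conn: "connected (with_proj G)"
    and "\<not> complete_digraph 1 (with_proj G)"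
  shows "1 \<le> acyclic_chromatic_index G"
proof (rule le_acyclic_chromatic_indexI[OF G])
  interpret pair_graph G by (rule G)
  fix c assume "acyclic_edge_colouring G c"
  obtain u where u: "u \<in> pverts G"
    using conn by (auto simp: connected_conv)
  have "pverts G \<noteq> {u}"
  proof
    assume "pverts G = {u}"
    moreover from this have "parcs G = {}"
      using wellformed' no_loops' by (metis equals0I prod.exhaust singletonD)
    ultimately show False
      using assms(3) by (auto simp: complete_digraph_pair_def)
  qed
  then obtain x y where xy: "(x, y) \<in> parcs G"
    using connected_leaving_arc[OF G conn, of "{u}"] u by blast
  have "uedges G \<noteq> {}"
    using in_uedges[OF xy] by blast
  then show "1 \<le> card (c ` uedges G)"
    using finite_uedges[OF G] by (simp add: Suc_le_eq card_gt_0_iff)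
qed

lemma index_ge_2:
  assumes G: "pair_graph G" and conn: "connected (with_proj G)"
    and "\<not> complete_digraph 1 (with_proj G)" "\<not> complete_digraph 2 (with_proj G)"
  shows "2 \<le> acyclic_chromatic_index G"
proof (rule le_acyclic_chromatic_indexI[OF G])
  interpret pair_graph G by (rule G)
  fix c assume c: "acyclic_edge_colouring G c"
  have "0 < card (c ` uedges G)"
    using index_ge_1[OF assms(1-3)] acyclic_chromatic_index_le[OF c] by linarith
  then obtain u v where uv: "(u, v) \<in> parcs G"
    by (auto simp: card_gt_0_iff uedges_def)
  have "pverts G \<noteq> {u, v}"
  proof
    assume V: "pverts G = {u, v}"
    have "u \<noteq> v" "(v, u) \<in> parcs G"
      using uv no_loops' arcs_symmetric by blast+
    have "(x, y) \<in> parcs G \<longleftrightarrow> (x, y) \<in> pverts G \<times> pverts G \<and> x \<noteq> y" for x y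
    proof
      assume "(x, y) \<in> pverts G \<times> pverts G \<and> x \<noteq> y"
      then have "x = u \<and> y = v \<or> x = v \<and> y = u"
        unfolding V by auto
      then show "(x, y) \<in> parcs G"
        using uv \<open>(v, u) \<in> parcs G\<close> by auto
    qed (use no_loops' wellformed' in blast)
    then have "parcs G = {(x, y). (x, y) \<in> pverts G \<times> pverts G \<and> x \<noteq> y}"
      by auto
    then show False
      using assms(4) V \<open>u \<noteq> v\<close> by (simp add: complete_digraph_pair_def)
  qed
  then obtain x y where xy: "(x, y) \<in> parcs G" "x \<in> {u, v}" "y \<notin> {u, v}"
    using connected_leaving_arc[OF G conn, of "{u, v}"] uv wellformed' by blast
  obtain z where z: "(x, z) \<in> parcs G" "{x, z} = {u, v}"
    using xy(2) uv arcs_symmetric by blast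
  then have "c {x, y} \<noteq> c {x, z}"
    using proper_edge_colouringD[of G c x y z] c xy by (auto simp: acyclic_edge_colouring_def)
  then have "card {c {x, y}, c {x, z}} = 2"
    by simp
  moreover have "{c {x, y}, c {x, z}} \<subseteq> c ` uedges G"
    using in_uedges[OF xy(1)] in_uedges[OF z(1)] by simp
  ultimately show "2 \<le> card (c ` uedges G)"
    using card_mono finite_uedges[OF G] by (metis finite_imageI)
qed

section \<open>The bound for the product\<close>

theorem theorem8:
  fixes G :: "'a pair_pre_digraph" and H :: "'b pair_pre_digraph"
  assumes "is_petersen_graph H \<or> complete_digraph 4 (with_proj H)"
    and "pair_graph G"
    and "connected (with_proj G)"
    and "\<not> complete_digraph 1 (with_proj G)"
    and "\<not> (is_petersen_graph H \<and> complete_digraph 2 (with_proj G))"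
  shows "acyclic_chromatic_index (G \<box> H)
    \<le> acyclic_chromatic_index G + acyclic_chromatic_index H - 1"
  using assms(1)
proof
  assume H: "is_petersen_graph H"
  let ?n = "acyclic_chromatic_index G"
  have "2 \<le> ?n"
    using index_ge_2 assms H by blast
  then obtain \<sigma> where "slot_colouring H ?n (?n + 3) \<sigma>"
    using is_petersen_slot_colouring[OF H] by blast
  then have "acyclic_chromatic_index (G \<box> H) \<le> ?n + 3"
    using acyclic_chromatic_index_box_product_le[OF assms(2) pair_graph_if_petersen[OF H]] by blast
  then show ?thesis
    using petersen_index_ge_4[OF H] by linarith
next
  assume H: "complete_digraph 4 (with_proj H)"
  then have "pair_graph H"
    using pair_graphI_graph by (auto simp: complete_digraph_def)
  have "1 \<le> acyclic_chromatic_index G"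
    using index_ge_1 assms by blast
  then have "\<exists>n. (n = 2 \<or> n = 4 \<or> 6 \<le> n) \<and> acyclic_chromatic_index G \<le> n \<and>
      n \<le> acyclic_chromatic_index G + 1"
    by presburger
  then obtain n where n: "n = 2 \<or> n = 4 \<or> 6 \<le> n" "acyclic_chromatic_index G \<le> n"
    "n \<le> acyclic_chromatic_index G + 1"
    by blast
  obtain \<sigma> where "slot_colouring H n (n + 3) \<sigma>"
    using k4_slot_colouring[OF H n(1)] by blast
  then have "acyclic_chromatic_index (G \<box> H) \<le> n + 3"
    using acyclic_chromatic_index_box_product_le[OF assms(2) \<open>pair_graph H\<close>] n(2) by blast
  then show ?thesis
    using k4_index_ge_5[OF H] n(3) by linarith
qed

end
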